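(* For $g_1,g_2\in G_\infty$ and $z_1,z_2\in\mathfrak Z$ we have: (1) $\iota(g_1z_1,g_2z_2)=\rho(g_1,g_2)\,\iota(z_1,z_2)$; (2) $j(\rho(g_1,g_2),\iota(z_1,z_2))\det(B(z_1,z_2))=j(g_1,z_1)\,\overline{j(g_2,z_2)}\,\det(B(g_1z_1,g_2z_2))$; (3) $\delta(\iota(z_1,z_2))=|\det(B(z_1,z_2))|^{-2}\,\delta(z_1)\delta(z_2)$.
   Context: Let $n=2m+r$ with $m>1$ and $N=2n$. $\mathbb C^a_b$ denotes $a\times b$ complex matrices; $X^*={}^t\overline X$. Let $J=\begin{bmatrix}0&-1\\1&0\end{bmatrix}$ and $J_m'=\mathrm{diag}[J,\dots,J]$ ($m$ copies). Put $$\phi_\infty=\begin{bmatrix}0&0&0&-1_{2m}\\0&0&-1_r&0\\0&1_r&0&0\\1_{2m}&0&0&0\end{bmatrix},\quad\psi_\infty=\begin{bmatrix}0&0&0&J_m'\\0&1_r&0&0\\0&0&1_r&0\\-J_m'&0&0&0\end{bmatrix},$$ $$G_\infty=\{g\in\mathrm{GL}_{2n}(\mathbb C):g^*\phi_\infty g=\phi_\infty,\ {}^tg\psi_\infty g=\psi_\infty\}.$$ **Symmetric space.** With $u_0=\begin{bmatrix}0&1_r\\1_{2m}&0\end{bmatrix}$ and $U(z)=\begin{bmatrix}z\\ u_0\end{bmatrix}$, let $\mathfrak Z=\{z\in\mathbb C^n_n:-iU(z)^*\phi_\infty U(z)>0,\ {}^tU(z)\psi_\infty U(z)=0\}$. Explicitly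 its points are $z=(u,v,w)=\begin{bmatrix}u&v\\ w\,{}^tvJ_m'&w\end{bmatrix}$ with $u\in\mathbb C^{2m}_{2m}$, $v\in\mathbb C^{2m}_r$, $w\in\mathbb C^r_r$, $i(z^*-z)>0$, ${}^tww+1=0$, $uJ_m'+v\,{}^tv-J_m'{}^tu=0$. For $g=\begin{bmatrix}a&b\\ c&d\end{bmatrix}\in G_\infty$ put $gz=(az+bu_0)(cz+du_0)^{-1}u_0$, $\lambda(g,z)=u_0^{-1}(cz+du_0)$, $j(g,z)=\det\lambda(g,z)$; thus $gU(z)=U(gz)\lambda(g,z)$. Put $\delta(z)=\det(i(z^*-z))$. **Doubling of groups.** $\rho(g_1,g_2)=R^{-1}\mathrm{diag}[g_1,g_2]R$ for $g_1,g_2\in G_\infty$, with (block sizes $2m,r,r,2m,2m,r,r,2m$; entries $\pm1,\pm\frac12$ mean the corresponding multiples of identity matrices) $$R=\begin{bmatrix}1&0&0&0&0&0&0&0\\0&\frac12&0&0&0&0&-1&0\\0&0&\frac12&0&0&1&0&0\\0&0&0&0&1&0&0&0\\0&0&0&-1&0&0&0&0\\0&-\frac12&0&0&0&0&-1&0\\0&0&-\frac12&0&0&1&0&0\\0&0&0&0&0&0&0&1\end{bmatrix}.$$ The target group is $G_{N\infty}=\{g\in\mathrm{GL}_{2N}(\mathbb C):g^*J_Ng=J_N,\ {}^tg\Psi_Ng=\Psi_N\}$, where $J_N=\begin{bmatrix}0&-1_N\\1_N&0\end{bmatrix}=R^*\mathrm{diag}[\phi_\infty,-\phi_\infty]R$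 and $\Psi_N={}^tR\,\mathrm{diag}[\psi_\infty,-\psi_\infty]R$. **Embedding of symmetric spaces.** Let $\mathfrak J=\begin{bmatrix}J_m'&0&0&0\\0&0&-1_r&0\\0&1_r&0&0\\0&0&0&J_m'\end{bmatrix}$ and define $A(z_1,z_2),B(z_1,z_2)\in\mathbb C^N_N$ by $$R^{-1}\begin{bmatrix}U(z_1)&0\\0&\mathfrak J\,\overline{U(z_2)}\end{bmatrix}=\begin{bmatrix}A(z_1,z_2)\\ B(z_1,z_2)\end{bmatrix};$$ explicitly, for $z_i=(u_i,v_i,w_i)$, $$A=\begin{bmatrix}u_1&v_1&0&0\\ w_1{}^tv_1J_m'&w_1&0&1\\0&1&-\overline w_2v_2^*J_m'&-\overline w_2\\0&0&-J_m'\overline u_2&-J_m'\overline v_2\end{bmatrix},\quad B=\begin{bmatrix}1&0&0&0\\0&\frac12&\frac{\overline w_2v_2^*J_m'}2&\frac{\overline w_2}2\\\frac{-w_1{}^tv_1J_m'}2&\frac{-w_1}2&0&\frac12\\0&0&J_m'&0\end{bmatrix}.$$ Let $S=\mathrm{diag}[1_{2m},\frac12 1_r,\frac12 1_r,1_{2m}]$. The symmetric space of $G_{N\infty}$ is $\mathfrak Z_N=\{Z\in\mathbb C^N_N:-iV^*J_NV>0,\ {}^tV\Psi_NV=0\text{ for }V=\begin{bmatrix}Z\\ S\end{bmatrix}\}$, with $gZ=(aZ+bS)(cZ+dS)^{-1}S$ and $j(g,Z)=\det(S^{-1}(cZ+dS))$ for $g=\begin{bmatrix}a&b\\ c&d\end{bmatrix}\in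 G_{N\infty}$. As on $\mathfrak Z$, put $\delta(Z)=\det(i(Z^*-Z))$ for $Z\in\mathfrak Z_N$. The embedding is $\iota:\mathfrak Z\times\mathfrak Z\to\mathfrak Z_N$, $\iota(z_1,z_2)=A(z_1,z_2)B(z_1,z_2)^{-1}S$; it sends $(i\cdot1_n,i\cdot1_n)$ to $i\cdot1_N$.
   Formalization: Part (3) is proved with δ(ι(z1,z2)S^{-1}) on the left instead of δ(ι(z1,z2)); the printed formula fails for r>0 (at z1=z2=i·1_n the left side is 2^N, the right side 2^{2r}·2^N), and the two agree for r=0. *)

theory Defs
  imports "Jordan_Normal_Form.Schur_Decomposition" "Jordan_Normal_Form.Gauss_Jordan_Elimination"
begin

text \<open>Throughout, \<open>n = 2 * m + r\<close> and \<open>N = 2 * n\<close>.  All matrices are explicit-dimension matrices,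
  so that \<open>r = 0\<close> (empty blocks) is allowed.\<close>

abbreviation dim_n :: "nat \<Rightarrow> nat \<Rightarrow> nat" where
  "dim_n m r \<equiv> 2 * m + r"

abbreviation dim_N :: "nat \<Rightarrow> nat \<Rightarrow> nat" where
  "dim_N m r \<equiv> 2 * dim_n m r"

text \<open>Unspecified when the argument is not invertible.\<close>

definition minv :: "complex mat \<Rightarrow> complex mat" where
  "minv A = the (mat_inverse A)"

abbreviation mat_cnj :: "complex mat \<Rightarrow> complex mat" where
  "mat_cnj A \<equiv> map_mat cnj A"

definition pos_def_mat :: "complex mat \<Rightarrow> bool" where
  "pos_def_mat A \<longleftrightarrow> square_mat A \<and> mat_adjoint A = A \<and>
     (\<forall>x \<in> carrier_vec (dim_row A). x \<noteq> 0\<^sub>v (dim_row A) \<longrightarrow> 0 < Re ((A *\<^sub>v x) \<bullet>c x))"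

definition block4 ::
  "complex mat \<Rightarrow> complex mat \<Rightarrow> complex mat \<Rightarrow> complex mat \<Rightarrow>
   complex mat \<Rightarrow> complex mat \<Rightarrow> complex mat \<Rightarrow> complex mat \<Rightarrow>
   complex mat \<Rightarrow> complex mat \<Rightarrow> complex mat \<Rightarrow> complex mat \<Rightarrow>
   complex mat \<Rightarrow> complex mat \<Rightarrow> complex mat \<Rightarrow> complex mat \<Rightarrow> complex mat" where
  "block4 a11 a12 a13 a14
          a21 a22 a23 a24
          a31 a32 a33 a34
          a41 a42 a43 a44 =
     four_block_mat (four_block_mat a11 a12 a21 a22) (four_block_mat a13 a14 a23 a24)
                    (four_block_mat a31 a32 a41 a42) (four_block_mat a33 a34 a43 a44)"


subsection \<open>Groups, spaces and actions attached to a pair of forms\<close>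

definition form_group :: "nat \<Rightarrow> complex mat \<Rightarrow> complex mat \<Rightarrow> complex mat set" where
  "form_group k \<phi> \<psi> = {g \<in> carrier_mat k k. invertible_mat g \<and>
     mat_adjoint g * \<phi> * g = \<phi> \<and> transpose_mat g * \<psi> * g = \<psi>}"

text \<open>Here \<open>s\<close> is the constant lower block under \<open>z\<close>: it is \<open>u\<^sub>0\<close> for the group \<open>G\<^sub>\<infinity>\<close> and \<open>S\<close> for the
  doubled group.\<close>

definition form_space ::
  "nat \<Rightarrow> complex mat \<Rightarrow> complex mat \<Rightarrow> complex mat \<Rightarrow> complex mat set" where
  "form_space k \<phi> \<psi> s = {z \<in> carrier_mat k k.
     pos_def_mat ((- \<i>) \<cdot>\<^sub>m (mat_adjoint (z @\<^sub>r s) * \<phi> * (z @\<^sub>r s))) \<and>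
     transpose_mat (z @\<^sub>r s) * \<psi> * (z @\<^sub>r s) = 0\<^sub>m k k}"

definition act :: "complex mat \<Rightarrow> complex mat \<Rightarrow> complex mat \<Rightarrow> complex mat" where
  "act s g z = (case split_block g (dim_row z) (dim_row z) of (a, b, c, d) \<Rightarrow>
     (a * z + b * s) * minv (c * z + d * s) * s)"

definition autom_mat :: "complex mat \<Rightarrow> complex mat \<Rightarrow> complex mat \<Rightarrow> complex mat" where
  "autom_mat s g z = (case split_block g (dim_row z) (dim_row z) of (a, b, c, d) \<Rightarrow>
     minv s * (c * z + d * s))"

definition autom :: "complex mat \<Rightarrow> complex mat \<Rightarrow> complex mat \<Rightarrow> complex" where
  "autom s g z = det (autom_mat s g z)"

definition delta :: "complex mat \<Rightarrow> complex" where
  "delta z = det (\<i> \<cdot>\<^sub>m (mat_adjoint z - z))"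


subsection \<open>The group \<open>G\<^sub>\<infinity>\<close> and its symmetric space\<close>

definition J2 :: "complex mat" where
  "J2 = mat_of_rows_list 2 [[0, -1], [1, 0]]"

definition Jm :: "nat \<Rightarrow> complex mat" where
  "Jm m = diag_block_mat (replicate m J2)"

definition phi_inf :: "nat \<Rightarrow> nat \<Rightarrow> complex mat" where
  "phi_inf m r = (let t = 2 * m in block4
     (0\<^sub>m t t)  (0\<^sub>m t r)  (0\<^sub>m t r)    (- 1\<^sub>m t)
     (0\<^sub>m r t)  (0\<^sub>m r r)  (- 1\<^sub>m r)    (0\<^sub>m r t)
     (0\<^sub>m r t)  (1\<^sub>m r)    (0\<^sub>m r r)    (0\<^sub>m r t)
     (1\<^sub>m t)    (0\<^sub>m t r)  (0\<^sub>m t r)    (0\<^sub>m t t))"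

definition psi_inf :: "nat \<Rightarrow> nat \<Rightarrow> complex mat" where
  "psi_inf m r = (let t = 2 * m in block4
     (0\<^sub>m t t)  (0\<^sub>m t r)  (0\<^sub>m t r)  (Jm m)
     (0\<^sub>m r t)  (1\<^sub>m r)    (0\<^sub>m r r)  (0\<^sub>m r t)
     (0\<^sub>m r t)  (0\<^sub>m r r)  (1\<^sub>m r)    (0\<^sub>m r t)
     (- Jm m)   (0\<^sub>m t r)  (0\<^sub>m t r)  (0\<^sub>m t t))"

definition G_inf :: "nat \<Rightarrow> nat \<Rightarrow> complex mat set" where
  "G_inf m r = form_group (2 * dim_n m r) (phi_inf m r) (psi_inf m r)"

definition u0 :: "nat \<Rightarrow> nat \<Rightarrow> complex mat" where
  "u0 m r = four_block_mat (0\<^sub>m r (2 * m)) (1\<^sub>m r) (1\<^sub>m (2 * m)) (0\<^sub>m (2 * m) r)"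

definition U_mat :: "nat \<Rightarrow> nat \<Rightarrow> complex mat \<Rightarrow> complex mat" where
  "U_mat m r z = z @\<^sub>r u0 m r"

definition Z_inf :: "nat \<Rightarrow> nat \<Rightarrow> complex mat set" where
  "Z_inf m r = form_space (dim_n m r) (phi_inf m r) (psi_inf m r) (u0 m r)"

definition act_inf :: "nat \<Rightarrow> nat \<Rightarrow> complex mat \<Rightarrow> complex mat \<Rightarrow> complex mat" where
  "act_inf m r = act (u0 m r)"

definition j_inf :: "nat \<Rightarrow> nat \<Rightarrow> complex mat \<Rightarrow> complex mat \<Rightarrow> complex" where
  "j_inf m r = autom (u0 m r)"


subsection \<open>The doubled group and its symmetric space\<close>

text \<open>The \<open>8 \<times> 8\<close> block matrix \<open>R\<close>, written as four \<open>4 \<times> 4\<close> quadrants.\<close>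

definition R_mat :: "nat \<Rightarrow> nat \<Rightarrow> complex mat" where
  "R_mat m r = (let t = 2 * m; h = (1/2) \<cdot>\<^sub>m 1\<^sub>m r in four_block_mat
     (block4 (1\<^sub>m t)    (0\<^sub>m t r)  (0\<^sub>m t r)  (0\<^sub>m t t)
             (0\<^sub>m r t)  h          (0\<^sub>m r r)  (0\<^sub>m r t)
             (0\<^sub>m r t)  (0\<^sub>m r r)  h          (0\<^sub>m r t)
             (0\<^sub>m t t)  (0\<^sub>m t r)  (0\<^sub>m t r)  (0\<^sub>m t t))
     (block4 (0\<^sub>m t t)  (0\<^sub>m t r)  (0\<^sub>m t r)  (0\<^sub>m t t)
             (0\<^sub>m r t)  (0\<^sub>m r r)  (- 1\<^sub>m r)  (0\<^sub>m r t)
             (0\<^sub>m r t)  (1\<^sub>m r)    (0\<^sub>m r r)  (0\<^sub>m r t)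
             (1\<^sub>m t)    (0\<^sub>m t r)  (0\<^sub>m t r)  (0\<^sub>m t t))
     (block4 (0\<^sub>m t t)  (0\<^sub>m t r)  (0\<^sub>m t r)  (- 1\<^sub>m t)
             (0\<^sub>m r t)  (- h)      (0\<^sub>m r r)  (0\<^sub>m r t)
             (0\<^sub>m r t)  (0\<^sub>m r r)  (- h)      (0\<^sub>m r t)
             (0\<^sub>m t t)  (0\<^sub>m t r)  (0\<^sub>m t r)  (0\<^sub>m t t))
     (block4 (0\<^sub>m t t)  (0\<^sub>m t r)  (0\<^sub>m t r)  (0\<^sub>m t t)
             (0\<^sub>m r t)  (0\<^sub>m r r)  (- 1\<^sub>m r)  (0\<^sub>m r t)
             (0\<^sub>m r t)  (1\<^sub>m r)    (0\<^sub>m r r)  (0\<^sub>m r t)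
             (0\<^sub>m t t)  (0\<^sub>m t r)  (0\<^sub>m t r)  (1\<^sub>m t)))"

definition rho :: "nat \<Rightarrow> nat \<Rightarrow> complex mat \<Rightarrow> complex mat \<Rightarrow> complex mat" where
  "rho m r g1 g2 = minv (R_mat m r) * diag_block_mat [g1, g2] * R_mat m r"

definition J_N :: "nat \<Rightarrow> nat \<Rightarrow> complex mat" where
  "J_N m r = (let N = dim_N m r in four_block_mat (0\<^sub>m N N) (- 1\<^sub>m N) (1\<^sub>m N) (0\<^sub>m N N))"

definition Psi_N :: "nat \<Rightarrow> nat \<Rightarrow> complex mat" where
  "Psi_N m r =
     transpose_mat (R_mat m r) * diag_block_mat [psi_inf m r, - psi_inf m r] * R_mat m r"

definition S_mat :: "nat \<Rightarrow> nat \<Rightarrow> complex mat" where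
  "S_mat m r = diag_block_mat
     [1\<^sub>m (2 * m), (1/2) \<cdot>\<^sub>m 1\<^sub>m r, (1/2) \<cdot>\<^sub>m 1\<^sub>m r, 1\<^sub>m (2 * m)]"

text \<open>The target of \<open>rho\<close> and the target of the embedding \<open>iota\<close> below.\<close>

definition G_N :: "nat \<Rightarrow> nat \<Rightarrow> complex mat set" where
  "G_N m r = form_group (2 * dim_N m r) (J_N m r) (Psi_N m r)"

definition Z_N :: "nat \<Rightarrow> nat \<Rightarrow> complex mat set" where
  "Z_N m r = form_space (dim_N m r) (J_N m r) (Psi_N m r) (S_mat m r)"

definition act_N :: "nat \<Rightarrow> nat \<Rightarrow> complex mat \<Rightarrow> complex mat \<Rightarrow> complex mat" where
  "act_N m r = act (S_mat m r)"

definition j_N :: "nat \<Rightarrow> nat \<Rightarrow> complex mat \<Rightarrow> complex mat \<Rightarrow> complex" where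
  "j_N m r = autom (S_mat m r)"

subsection \<open>The embedding of symmetric spaces\<close>

definition frak_J :: "nat \<Rightarrow> nat \<Rightarrow> complex mat" where
  "frak_J m r = (let t = 2 * m in block4
     (Jm m)     (0\<^sub>m t r)  (0\<^sub>m t r)  (0\<^sub>m t t)
     (0\<^sub>m r t)  (0\<^sub>m r r)  (- 1\<^sub>m r)  (0\<^sub>m r t)
     (0\<^sub>m r t)  (1\<^sub>m r)    (0\<^sub>m r r)  (0\<^sub>m r t)
     (0\<^sub>m t t)  (0\<^sub>m t r)  (0\<^sub>m t r)  (Jm m))"

definition AB_mat :: "nat \<Rightarrow> nat \<Rightarrow> complex mat \<Rightarrow> complex mat \<Rightarrow> complex mat" where
  "AB_mat m r z1 z2 =
     minv (R_mat m r) * diag_block_mat [U_mat m r z1, frak_J m r * mat_cnj (U_mat m r z2)]"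

definition A_mat :: "nat \<Rightarrow> nat \<Rightarrow> complex mat \<Rightarrow> complex mat \<Rightarrow> complex mat" where
  "A_mat m r z1 z2 =
     (case split_block (AB_mat m r z1 z2) (dim_N m r) (dim_N m r) of (A, _, B, _) \<Rightarrow> A)"

definition B_mat :: "nat \<Rightarrow> nat \<Rightarrow> complex mat \<Rightarrow> complex mat \<Rightarrow> complex mat" where
  "B_mat m r z1 z2 =
     (case split_block (AB_mat m r z1 z2) (dim_N m r) (dim_N m r) of (A, _, B, _) \<Rightarrow> B)"

definition iota :: "nat \<Rightarrow> nat \<Rightarrow> complex mat \<Rightarrow> complex mat \<Rightarrow> complex mat" where
  "iota m r z1 z2 = A_mat m r z1 z2 * minv (B_mat m r z1 z2) * S_mat m r"

text \<open>Pitfall: on \<open>Z_N\<close> the function \<open>delta\<close> has to be evaluated at \<open>Z S\<^sup>-\<^sup>1\<close> instead of \<open>Z\<close>.  In the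
  coordinate \<open>Z\<close>, with lower block \<open>S\<close>, the positive hermitian form is \<open>\<i> (Z\<^sup>* S - S Z)\<close>; it becomes
  \<open>\<i> (X\<^sup>* - X)\<close>, as on the space of \<open>G\<^sub>\<infinity>\<close>, in the coordinate \<open>X = Z S\<^sup>-\<^sup>1\<close> with lower block \<open>1\<close>.
  For \<open>r = 0\<close> there is no difference, as \<open>S = 1\<close>.  For \<open>r > 0\<close> the formula
  \<open>delta (iota z\<^sub>1 z\<^sub>2) = |det B|\<^sup>-\<^sup>2 delta z\<^sub>1 delta z\<^sub>2\<close> fails: at \<open>z\<^sub>1 = z\<^sub>2 = \<i> 1\<^sub>n\<close> one has
  \<open>iota z\<^sub>1 z\<^sub>2 = \<i> 1\<^sub>N\<close> and \<open>|det B| = 2\<^sup>-\<^sup>r\<close>, so the left side is \<open>2\<^sup>N\<close> and the right side is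
  \<open>2\<^sup>2\<^sup>r 2\<^sup>N\<close>.  It holds for all \<open>r\<close> with \<open>iota z\<^sub>1 z\<^sub>2 * minv (S_mat m r)\<close> on the left.\<close>

end

theory Submission
  imports Defs
begin

text \<open>
  Put \<open>\<J> = frak_J m r\<close>.  The two equations defining \<open>G_inf\<close> together give \<open>g \<J> = \<J> cnj(g)\<close>,
  because \<open>\<J> = \<phi> \<psi>\<close>.  Hence multiplying the frame \<open>diag(U(z\<^sub>1), \<J> cnj(U(z\<^sub>2)))\<close> on the left
  by \<open>diag(g\<^sub>1, g\<^sub>2)\<close> turns it into the frame at \<open>(g\<^sub>1 z\<^sub>1, g\<^sub>2 z\<^sub>2)\<close> times
  \<open>diag(\<lambda>\<^sub>1, cnj(\<lambda>\<^sub>2))\<close>, which yields (1) and (2) after conjugation by \<open>R\<close>.  The identity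
  \<open>R\<^sup>* diag(\<phi>, -\<phi>) R = J\<^sub>N\<close> shows that \<open>-\<i> V\<^sup>* J\<^sub>N V\<close>, for the frame \<open>V\<close> with blocks
  \<open>A\<close> and \<open>B\<close>, is the block-diagonal matrix of the positive definite forms at \<open>z\<^sub>1\<close> and (conjugated) at
  \<open>z\<^sub>2\<close>.  Positivity makes \<open>B\<close> invertible, since the form vanishes on the kernel of \<open>B\<close>; taking
  determinants gives (3).
\<close>

section \<open>Adjoints and entrywise conjugates of complex matrices\<close>

lemma mat_adjoint_eq: "mat_adjoint (A :: complex mat) = transpose_mat (mat_cnj A)"
  by (rule eq_matI) (auto simp: mat_adjoint_def mat_of_rows_def)

lemma dim_mat_adjoint [simp]:
  "dim_row (mat_adjoint (A :: complex mat)) = dim_col A"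
  "dim_col (mat_adjoint (A :: complex mat)) = dim_row A"
  by (auto simp: mat_adjoint_eq)

lemma mat_adjoint_carrier [simp, intro]:
  "(A :: complex mat) \<in> carrier_mat a b \<Longrightarrow> mat_adjoint A \<in> carrier_mat b a"
  by (auto simp: mat_adjoint_eq)

lemma index_mat_adjoint [simp]:
  "i < dim_col A \<Longrightarrow> j < dim_row A \<Longrightarrow> mat_adjoint (A :: complex mat) $$ (i, j) = cnj (A $$ (j, i))"
  by (auto simp: mat_adjoint_eq)

lemma mat_adjoint_zero [simp]: "mat_adjoint (0\<^sub>m a b :: complex mat) = 0\<^sub>m b a"
  by (rule eq_matI) auto

lemma mat_adjoint_one [simp]: "mat_adjoint (1\<^sub>m a :: complex mat) = 1\<^sub>m a"
  by (rule eq_matI) auto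

lemma mat_adjoint_uminus [simp]: "mat_adjoint (- A :: complex mat) = - mat_adjoint A"
  by (rule eq_matI) auto

lemma mat_adjoint_smult [simp]: "mat_adjoint (c \<cdot>\<^sub>m A :: complex mat) = cnj c \<cdot>\<^sub>m mat_adjoint A"
  by (rule eq_matI) auto

lemma mat_cnj_zero [simp]: "mat_cnj (0\<^sub>m a b) = 0\<^sub>m a b"
  by (rule eq_matI) auto

lemma mat_cnj_one [simp]: "mat_cnj (1\<^sub>m a) = 1\<^sub>m a"
  by (rule eq_matI) auto

lemma mat_cnj_uminus [simp]: "mat_cnj (- A) = - mat_cnj A"
  by (rule eq_matI) auto

lemma uminus_zero_mat [simp]: "- 0\<^sub>m a b = (0\<^sub>m a b :: complex mat)"
  by (rule eq_matI) auto

lemma mat_cnj_mult: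
  assumes "A \<in> carrier_mat a b" "B \<in> carrier_mat b c"
  shows "mat_cnj (A * B) = mat_cnj A * mat_cnj B"
proof -
  interpret semiring_hom cnj by unfold_locales auto
  show ?thesis by (rule mat_hom_mult[OF assms])
qed

lemma mat_adjoint_mult:
  assumes "(A :: complex mat) \<in> carrier_mat a b" "B \<in> carrier_mat b c"
  shows "mat_adjoint (A * B) = mat_adjoint B * mat_adjoint A"
  using assms
  by (simp add: mat_adjoint_eq mat_cnj_mult[OF assms] transpose_mult[of "mat_cnj A" a b "mat_cnj B" c])

lemma det_mat_cnj: "det (mat_cnj A) = cnj (det A)"
proof -
  interpret comm_ring_hom cnj by unfold_locales auto
  show ?thesis by simp
qed

lemma det_mat_adjoint:
  assumes "(A :: complex mat) \<in> carrier_mat n n"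
  shows "det (mat_adjoint A) = cnj (det A)"
  using assms by (simp add: mat_adjoint_eq det_transpose[of _ n] det_mat_cnj)

lemma mat_adjoint_four_block_mat:
  assumes "A \<in> carrier_mat nr1 nc1" "B \<in> carrier_mat nr1 nc2"
    "C \<in> carrier_mat nr2 nc1" "D \<in> carrier_mat nr2 nc2"
  shows "mat_adjoint (four_block_mat A B C D :: complex mat) =
    four_block_mat (mat_adjoint A) (mat_adjoint C) (mat_adjoint B) (mat_adjoint D)"
  by (rule eq_matI, insert assms, auto)

text \<open>Reduces to the bilinear rule for the transpose, applied to \<open>mat_cnj A\<close> and
  \<open>conjugate y\<close>. It moves a lower block across the scalar product onto a kernel
  vector.\<close>

lemma mat_adjoint_scalar_prod:
  assumes A: "(A :: complex mat) \<in> carrier_mat a b" and x: "x \<in> carrier_vec a" and y: "y \<in> carrier_vec b"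
  shows "(mat_adjoint A *\<^sub>v x) \<bullet>c y = x \<bullet>c (A *\<^sub>v y)"
proof -
  have "conjugate (A *\<^sub>v y) = mat_cnj A *\<^sub>v conjugate y"
    using A y by (intro eq_vecI) (auto simp: scalar_prod_def)
  moreover have "(mat_adjoint A *\<^sub>v x) \<bullet>c y = (x \<bullet> (mat_cnj A *\<^sub>v conjugate y))"
    using transpose_vec_mult_scalar[of "mat_cnj A" a b "conjugate y" x] A x y
    by (auto simp: mat_adjoint_eq)
  ultimately show ?thesis by simp
qed

text \<open>\<open>minv\<close> is the content of an option and carries information only for
  invertible arguments. Invertibility is always supplied as a nonzero determinant, because
  determinants of products and of block-diagonal matrices factor.\<close>

lemma minv:
  assumes A: "A \<in> carrier_mat n n" and d: "det A \<noteq> 0"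
  shows "minv A \<in> carrier_mat n n" "A * minv A = 1\<^sub>m n" "minv A * A = 1\<^sub>m n"
proof -
  from det_non_zero_imp_unit[OF A d, of "()"] mat_inverse(1)[OF A, of "()"]
  obtain B where "mat_inverse A = Some B" by fastforce
  with mat_inverse(2)[OF A this]
  show "minv A \<in> carrier_mat n n" "A * minv A = 1\<^sub>m n" "minv A * A = 1\<^sub>m n"
    by (auto simp: minv_def)
qed

lemma det_minv:
  assumes "A \<in> carrier_mat n n" "det A \<noteq> 0"
  shows "det (minv A) = 1 / det A"
  using det_mult[OF assms(1) minv(1)[OF assms]] minv(2)[OF assms] assms(2)
  by (simp add: field_simps)

section \<open>Block-diagonal matrices with two blocks, and frames stacked by
  \<open>@\<^sub>r\<close>\<close>

lemma diag_block_mat_two: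
  "diag_block_mat [A, B] = four_block_mat A (0\<^sub>m (dim_row A) (dim_col B)) (0\<^sub>m (dim_row B) (dim_col A)) B"
  by (subst diag_block_mat.simps(2)) (simp only: diag_block_mat_singleton Let_def)

lemma diag_block_mat_two_carrier [simp]:
  "A \<in> carrier_mat a b \<Longrightarrow> B \<in> carrier_mat c d \<Longrightarrow> diag_block_mat [A, B] \<in> carrier_mat (a + c) (b + d)"
  by (auto simp: diag_block_mat_two)

lemma diag_block_mat_two_mult:
  assumes "A \<in> carrier_mat a b" "B \<in> carrier_mat c d" "A' \<in> carrier_mat b e" "B' \<in> carrier_mat d f"
  shows "diag_block_mat [A, B] * diag_block_mat [A', B'] = diag_block_mat [A * A', B * B' :: complex mat]"
  using assms unfolding diag_block_mat_two
  by (subst mult_four_block_mat[of _ a b _ d _ c _ _ e _ f]) auto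

lemma mat_adjoint_diag_block_mat_two:
  "mat_adjoint (diag_block_mat [A, B] :: complex mat) = diag_block_mat [mat_adjoint A, mat_adjoint B]"
  unfolding diag_block_mat_two by (rule eq_matI) auto

lemma det_diag_block_mat_two:
  assumes "A \<in> carrier_mat a a" "B \<in> carrier_mat b b"
  shows "det (diag_block_mat [A, B] :: complex mat) = det A * det B"
  unfolding diag_block_mat_two using assms by (subst det_four_block_mat_upper_right_zero[of _ a _ b]) auto

lemma append_rows_mult:
  assumes "X \<in> carrier_mat a n" "Y \<in> carrier_mat b n" "M \<in> carrier_mat n c"
  shows "(X @\<^sub>r Y) * M = (X * M) @\<^sub>r (Y * M :: complex mat)"
proof -
  \<comment> \<open>\<open>@\<^sub>r\<close> is a \<open>four_block_mat\<close> whose right blocks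
    have width 0; padding \<open>M\<close> with empty blocks makes the block product rule
    applicable.\<close>
  have M: "M = four_block_mat M (0\<^sub>m n 0) (0\<^sub>m 0 c) (0\<^sub>m 0 0)"
    using assms(3) by (intro eq_matI) auto
  show ?thesis
    unfolding append_rows_def using assms
    by (subst M, subst mult_four_block_mat[of _ a n _ 0 _ b]) auto
qed

lemma four_block_mat_mult_append_rows:
  assumes "a \<in> carrier_mat k n" "b \<in> carrier_mat k l" "c \<in> carrier_mat h n" "d \<in> carrier_mat h l"
    "X \<in> carrier_mat n e" "Y \<in> carrier_mat l e"
  shows "four_block_mat a b c d * (X @\<^sub>r Y) = (a * X + b * Y) @\<^sub>r (c * X + d * Y :: complex mat)"
  unfolding append_rows_def using assms
  by (subst mult_four_block_mat[of _ k n _ l _ h _ _ e _ 0]) auto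

lemma adjoint_append_rows_mult:
  assumes "X \<in> carrier_mat a n" "Y \<in> carrier_mat b n" "X' \<in> carrier_mat a c" "Y' \<in> carrier_mat b c"
  shows "mat_adjoint (X @\<^sub>r Y) * (X' @\<^sub>r Y') = mat_adjoint X * X' + (mat_adjoint Y * Y' :: complex mat)"
proof -
  have adj: "mat_adjoint (X @\<^sub>r Y) =
      four_block_mat (mat_adjoint X) (mat_adjoint Y) (0\<^sub>m 0 a) (0\<^sub>m 0 b)"
    unfolding append_rows_def using assms by (intro eq_matI) auto
  show ?thesis
    unfolding adj unfolding append_rows_def using assms
    by (subst mult_four_block_mat[of _ n a _ b _ 0 _ _ c _ 0]) (auto intro!: eq_matI)
qed

lemma append_rows_eq_iff:
  assumes "X \<in> carrier_mat a n" "Y \<in> carrier_mat b n" "X' \<in> carrier_mat a n" "Y' \<in> carrier_mat b n"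
  shows "X @\<^sub>r Y = X' @\<^sub>r Y' \<longleftrightarrow> X = X' \<and> Y = Y'"
proof
  assume eq: "X @\<^sub>r Y = X' @\<^sub>r Y'"
  have "(X @\<^sub>r Y) $$ (i, j) = X $$ (i, j)" "(X' @\<^sub>r Y') $$ (i, j) = X' $$ (i, j)"
    if "i < a" "j < n" for i j
    using assms that by (auto simp: append_rows_def)
  moreover have "(X @\<^sub>r Y) $$ (a + i, j) = Y $$ (i, j)" "(X' @\<^sub>r Y') $$ (a + i, j) = Y' $$ (i, j)"
    if "i < b" "j < n" for i j
    using assms that by (auto simp: append_rows_def)
  ultimately show "X = X' \<and> Y = Y'"
    using assms unfolding eq by (intro conjI eq_matI) (metis carrier_matD | simp)+
qed simp

text \<open>The column cut falls at the full width \<open>n = n + 0\<close>, so \<open>X'\<close>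
  and \<open>Y'\<close> are empty and the remaining two components are the upper and lower halves of
  a frame.\<close>

lemma split_block_append_rows:
  assumes "M \<in> carrier_mat (a + b) n"
  obtains X X' Y Y' where "split_block M a n = (X, X', Y, Y')" "M = X @\<^sub>r Y"
    "X \<in> carrier_mat a n" "Y \<in> carrier_mat b n"
proof -
  obtain X X' Y Y' where s: "split_block M a n = (X, X', Y, Y')" by (metis prod_cases4)
  have d: "dim_row M = a + b" "dim_col M = n + 0" using assms by auto
  note * = split_block[OF s d]
  have "M = X @\<^sub>r Y"
    using * by (auto simp: append_rows_def intro!: cong_four_block_mat)
  with s * that show thesis by blast
qed

subsection \<open>Forms with vanishing diagonal blocks, and the action\<close>

lemma smult_mat_mult_vec:
  "v \<in> carrier_vec (dim_col A) \<Longrightarrow> (c \<cdot>\<^sub>m A) *\<^sub>v v = c \<cdot>\<^sub>v (A *\<^sub>v v :: complex vec)"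
  by (intro eq_vecI) auto

text \<open>Both \<open>phi_inf\<close> and \<open>J_N\<close> have this shape. The vanishing
  diagonal blocks leave only the two cross terms between the halves of the frame.\<close>

lemma off_diagonal_form:
  assumes "X \<in> carrier_mat k l" "Y \<in> carrier_mat k l" "p \<in> carrier_mat k k" "q \<in> carrier_mat k k"
  shows "mat_adjoint (X @\<^sub>r Y) * four_block_mat (0\<^sub>m k k) p q (0\<^sub>m k k) * (X @\<^sub>r Y)
    = mat_adjoint X * (p * Y) + mat_adjoint Y * (q * X :: complex mat)"
proof -
  let ?F = "four_block_mat (0\<^sub>m k k) p q (0\<^sub>m k k)"
  have c: "X @\<^sub>r Y \<in> carrier_mat (k + k) l" "?F \<in> carrier_mat (k + k) (k + k)"
    using assms by auto
  have "?F * (X @\<^sub>r Y) = (p * Y) @\<^sub>r (q * X)"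
    by (subst four_block_mat_mult_append_rows[of _ k k _ k _ k _ _ l]) (use assms in auto)
  then have "mat_adjoint (X @\<^sub>r Y) * (?F * (X @\<^sub>r Y)) = mat_adjoint X * (p * Y) + mat_adjoint Y * (q * X)"
    using adjoint_append_rows_mult[of X k l Y k "p * Y" l "q * X"] assms by simp
  then show ?thesis
    using assoc_mult_mat[OF mat_adjoint_carrier[OF c(1)] c(2) c(1)] by simp
qed

text \<open>A kernel vector \<open>v\<close> of \<open>Y\<close> is isotropic: the first cross term
  contains \<open>Y v\<close> on the right, and in the second the adjoint of \<open>Y\<close> moves
  across the scalar product and again meets \<open>Y v\<close>. A positive definite form has no
  nonzero isotropic vector.\<close>

lemma pos_def_off_diagonal_form_lower_block:
  assumes XY: "X \<in> carrier_mat k k" "Y \<in> carrier_mat k k" and pq: "p \<in> carrier_mat k k" "q \<in> carrier_mat k k"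
    and pos: "pos_def_mat ((- \<i>) \<cdot>\<^sub>m
      (mat_adjoint (X @\<^sub>r Y) * four_block_mat (0\<^sub>m k k) p q (0\<^sub>m k k) * (X @\<^sub>r Y)))"
  shows "det Y \<noteq> 0"
proof
  assume "det Y = 0"
  then obtain v where v: "v \<in> carrier_vec k" "v \<noteq> 0\<^sub>v k" "Y *\<^sub>v v = 0\<^sub>v k"
    using det_0_iff_vec_prod_zero[OF XY(2)] by auto
  define w where "w = q * X *\<^sub>v v"
  define H where "H = (- \<i>) \<cdot>\<^sub>m (mat_adjoint X * (p * Y) + mat_adjoint Y * (q * X))"
  have H: "H \<in> carrier_mat k k" and w: "w \<in> carrier_vec k"
    using XY pq v by (auto simp: H_def w_def)
  have "mat_adjoint X * (p * Y) *\<^sub>v v = mat_adjoint X *\<^sub>v (p *\<^sub>v (Y *\<^sub>v v))"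
    using XY pq v(1) by (simp add: assoc_mult_mat_vec[of _ k k _ k] mult_carrier_mat[of _ k k _ k])
  also have "\<dots> = 0\<^sub>v k"
  proof -
    have "p *\<^sub>v 0\<^sub>v k = 0\<^sub>v k" "mat_adjoint X *\<^sub>v 0\<^sub>v k = 0\<^sub>v k"
      using XY pq by (auto intro!: eq_vecI simp: scalar_prod_def)
    then show ?thesis using v(3) by simp
  qed
  finally have 1: "mat_adjoint X * (p * Y) *\<^sub>v v = 0\<^sub>v k" .
  have "mat_adjoint Y * (q * X) *\<^sub>v v = mat_adjoint Y *\<^sub>v w"
    unfolding w_def by (rule assoc_mult_mat_vec[of _ k k _ k]) (use XY pq v in auto)
  moreover have "(mat_adjoint X * (p * Y) + mat_adjoint Y * (q * X)) *\<^sub>v v =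
      mat_adjoint X * (p * Y) *\<^sub>v v + mat_adjoint Y * (q * X) *\<^sub>v v"
    by (rule add_mult_distrib_mat_vec[of _ k k]) (use XY pq v in auto)
  moreover have "mat_adjoint Y *\<^sub>v w \<in> carrier_vec k"
    by (rule mult_mat_vec_carrier[of _ k k]) (use XY w in auto)
  ultimately have "(mat_adjoint X * (p * Y) + mat_adjoint Y * (q * X)) *\<^sub>v v = mat_adjoint Y *\<^sub>v w"
    using 1 by simp
  then have "H *\<^sub>v v = (- \<i>) \<cdot>\<^sub>v (mat_adjoint Y *\<^sub>v w)"
    unfolding H_def using XY pq v by (subst smult_mat_mult_vec) auto
  then have "(H *\<^sub>v v) \<bullet>c v = (- \<i>) * ((mat_adjoint Y *\<^sub>v w) \<bullet>c v)"
    using XY w v by auto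
  also have "(mat_adjoint Y *\<^sub>v w) \<bullet>c v = w \<bullet>c (Y *\<^sub>v v)"
    by (rule mat_adjoint_scalar_prod[OF XY(2) w v(1)])
  also have "\<dots> = 0"
    using w v by simp
  finally have "(H *\<^sub>v v) \<bullet>c v = 0" by simp
  moreover have "pos_def_mat H"
    using pos off_diagonal_form[OF XY pq] by (simp add: H_def)
  ultimately show False
    using v H by (force simp: pos_def_mat_def)
qed

text \<open>The value of the conjugated form at \<open>x\<close> is the complex conjugate of the
  value of \<open>H\<close> at \<open>conjugate x\<close>, so the real parts agree.\<close>

lemma pos_def_mat_cnj:
  assumes "pos_def_mat H"
  shows "pos_def_mat (mat_cnj H)"
proof -
  define n where "n = dim_row H"
  have H: "H \<in> carrier_mat n n" and adj: "mat_adjoint H = H"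
    and pos: "\<And>x. x \<in> carrier_vec n \<Longrightarrow> x \<noteq> 0\<^sub>v n \<Longrightarrow> 0 < Re ((H *\<^sub>v x) \<bullet>c x)"
    using assms by (auto simp: pos_def_mat_def n_def)
  have "mat_adjoint (mat_cnj H) = mat_cnj (mat_adjoint H)"
    by (rule eq_matI) auto
  moreover have "0 < Re ((mat_cnj H *\<^sub>v x) \<bullet>c x)" if x: "x \<in> carrier_vec n" "x \<noteq> 0\<^sub>v n" for x
  proof -
    have "(mat_cnj H *\<^sub>v x) \<bullet>c x = cnj ((H *\<^sub>v conjugate x) \<bullet>c conjugate x)"
      using H x by (auto simp: scalar_prod_def)
    moreover have "conjugate x \<noteq> 0\<^sub>v n"
      using x by (metis conjugate_zero_vec conjugate_id)
    ultimately show ?thesis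
      using pos[of "conjugate x"] x by simp
  qed
  ultimately show ?thesis
    using H adj by (auto simp: pos_def_mat_def)
qed

lemma pos_def_mat_diag_block:
  assumes "pos_def_mat A" "pos_def_mat B"
  shows "pos_def_mat (diag_block_mat [A, B])"
proof -
  define a b where "a = dim_row A" and "b = dim_row B"
  have A: "A \<in> carrier_mat a a" "mat_adjoint A = A"
      "\<And>x. x \<in> carrier_vec a \<Longrightarrow> x \<noteq> 0\<^sub>v a \<Longrightarrow> 0 < Re ((A *\<^sub>v x) \<bullet>c x)"
    and B: "B \<in> carrier_mat b b" "mat_adjoint B = B"
      "\<And>x. x \<in> carrier_vec b \<Longrightarrow> x \<noteq> 0\<^sub>v b \<Longrightarrow> 0 < Re ((B *\<^sub>v x) \<bullet>c x)"
    using assms by (auto simp: pos_def_mat_def a_def b_def)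
  have "0 < Re ((diag_block_mat [A, B] *\<^sub>v x) \<bullet>c x)" if x: "x \<in> carrier_vec (a + b)" "x \<noteq> 0\<^sub>v (a + b)" for x
  proof -
    define y z where "y = vec_first x a" and "z = vec_last x b"
    have yz: "x = y @\<^sub>v z" "y \<in> carrier_vec a" "z \<in> carrier_vec b"
      using x by (auto simp: y_def z_def)
    have "diag_block_mat [A, B] *\<^sub>v x = (A *\<^sub>v y) @\<^sub>v (B *\<^sub>v z)"
      unfolding yz(1) diag_block_mat_two
      using A B yz by (subst four_block_mat_mult_vec[of _ a a _ b _ b]) auto
    moreover have "conjugate x = conjugate y @\<^sub>v conjugate z"
      using yz by (auto intro!: eq_vecI)
    ultimately have "(diag_block_mat [A, B] *\<^sub>v x) \<bullet>c x = (A *\<^sub>v y) \<bullet>c y + (B *\<^sub>v z) \<bullet>c z"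
      using A B yz by (simp add: scalar_prod_append[of _ a _ b])
    moreover have "y \<noteq> 0\<^sub>v a \<or> z \<noteq> 0\<^sub>v b"
      using x(2) yz(1) by auto
    \<comment> \<open>One of the two components may vanish, so each summand is first bounded below
      by 0; strictness comes from the nonzero component.\<close>
    moreover have "0 \<le> Re ((A *\<^sub>v y) \<bullet>c y)"
      using A(1) A(3)[OF yz(2)] by (cases "y = 0\<^sub>v a") auto
    moreover have "0 \<le> Re ((B *\<^sub>v z) \<bullet>c z)"
      using B(1) B(3)[OF yz(3)] by (cases "z = 0\<^sub>v b") auto
    ultimately show ?thesis
      using A(3)[OF yz(2)] B(3)[OF yz(3)] by fastforce
  qed
  moreover have "diag_block_mat [A, B] \<in> carrier_mat (a + b) (a + b)"
    using A B by (intro diag_block_mat_two_carrier)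
  moreover have "mat_adjoint (diag_block_mat [A, B]) = diag_block_mat [A, B]"
    using A B by (simp only: mat_adjoint_diag_block_mat_two)
  ultimately show ?thesis
    unfolding pos_def_mat_def square_mat.simps by (metis carrier_matD)
qed

section \<open>The action and the factor of automorphy, read off from frames\<close>

lemma act_eq:
  assumes g: "g \<in> carrier_mat (k + k) (k + k)" and z: "z \<in> carrier_mat k k" and s: "s \<in> carrier_mat k k"
    and gz: "g * (z @\<^sub>r s) = X @\<^sub>r Y" and X: "X \<in> carrier_mat k k" and Y: "Y \<in> carrier_mat k k"
  shows "act s g z = X * minv Y * s" "autom_mat s g z = minv s * Y"
proof -
  obtain a b c d where sp: "split_block g k k = (a, b, c, d)" by (metis prod_cases4)
  note * = split_block[OF sp, of k k]
  have cr: "a \<in> carrier_mat k k" "b \<in> carrier_mat k k" "c \<in> carrier_mat k k" "d \<in> carrier_mat k k"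
    "g = four_block_mat a b c d" using * g by auto
  \<comment> \<open>The numerator and denominator in the definition of \<open>act\<close> are the
    two halves of \<open>g\<close> times the frame, and the halves of a frame are unique.\<close>
  have "g * (z @\<^sub>r s) = (a * z + b * s) @\<^sub>r (c * z + d * s)"
    unfolding cr(5) by (rule four_block_mat_mult_append_rows) (use cr z s in auto)
  then have "X = a * z + b * s \<and> Y = c * z + d * s"
    using gz X Y cr z s by (subst append_rows_eq_iff[of _ k k _ k, symmetric]) auto
  then show "act s g z = X * minv Y * s" "autom_mat s g z = minv s * Y"
    using z sp by (auto simp: act_def autom_mat_def)
qed

text \<open>This is \<open>g U(z) = U(g z) \<lambda>(g, z)\<close> for a general lower block
  \<open>s\<close>. In the upper half \<open>s\<close> cancels against \<open>minv s\<close> and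
  then \<open>minv Y\<close> against \<open>Y\<close>; in the lower half only \<open>s\<close>
  against \<open>minv s\<close>.\<close>

lemma act_frame:
  assumes g: "g \<in> carrier_mat (k + k) (k + k)" and z: "z \<in> carrier_mat k k"
    and s: "s \<in> carrier_mat k k" "det s \<noteq> 0"
    and gz: "g * (z @\<^sub>r s) = X @\<^sub>r Y" and X: "X \<in> carrier_mat k k" and Y: "Y \<in> carrier_mat k k" "det Y \<noteq> 0"
  shows "act s g z \<in> carrier_mat k k" "autom_mat s g z \<in> carrier_mat k k"
    "g * (z @\<^sub>r s) = (act s g z @\<^sub>r s) * autom_mat s g z"
proof -
  note eq = act_eq[OF g z s(1) gz X Y(1)]
  note ms = minv[OF s] and mY = minv[OF Y]
  show c: "act s g z \<in> carrier_mat k k" "autom_mat s g z \<in> carrier_mat k k"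
    using eq ms mY X Y s by auto
  have "act s g z * autom_mat s g z = X * (minv Y * (s * minv s) * Y)"
    unfolding eq using ms(1) mY(1) X Y s
    by (simp add: assoc_mult_mat[of _ k k _ k _ k] mult_carrier_mat[of _ k k _ k])
  also have "\<dots> = X" using ms mY X Y by simp
  finally have 1: "act s g z * autom_mat s g z = X" .
  have "s * autom_mat s g z = (s * minv s) * Y"
    unfolding eq using ms(1) s(1) Y(1) by (simp add: assoc_mult_mat[of _ k k _ k _ k])
  then have 2: "s * autom_mat s g z = Y" using ms Y by simp
  show "g * (z @\<^sub>r s) = (act s g z @\<^sub>r s) * autom_mat s g z"
    using append_rows_mult[OF c(1) s(1) c(2)] 1 2 gz by simp
qed

text \<open>A frame acts as a homogeneous coordinate: right multiplication by an invertible matrix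
  keeps the point, and \<open>A * minv B * s\<close> is the representative with lower block
  \<open>s\<close>. So one identity between frames with right factor \<open>L\<close> gives the
  image point and, by comparing lower blocks, the factor of automorphy.\<close>

lemma act_of_frame:
  assumes g: "g \<in> carrier_mat (k + k) (k + k)" and s: "s \<in> carrier_mat k k" "det s \<noteq> 0"
    and A: "A \<in> carrier_mat k k" and B: "B \<in> carrier_mat k k" "det B \<noteq> 0"
    and A': "A' \<in> carrier_mat k k" and B': "B' \<in> carrier_mat k k" "det B' \<noteq> 0"
    and L: "L \<in> carrier_mat k k" "det L \<noteq> 0"
    and eq: "g * (A @\<^sub>r B) = (A' @\<^sub>r B') * L"
  shows "act s g (A * minv B * s) = A' * minv B' * s"
    "autom s g (A * minv B * s) * det B = det L * det B'"
proof -
  note ms = minv[OF s] and mB = minv[OF B] and mB' = minv[OF B']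
  \<comment> \<open>\<open>M\<close> normalises the frame \<open>A @\<^sub>r B\<close> to lower
    block \<open>s\<close>; \<open>P\<close> is the right factor that results on the image
    side.\<close>
  define M where "M = minv B * s"
  define P where "P = L * M"
  have M: "M \<in> carrier_mat k k" using mB s by (auto simp: M_def)
  have P: "P \<in> carrier_mat k k" using M L by (auto simp: P_def)
  have z: "A * minv B * s = A * M"
    unfolding M_def by (rule assoc_mult_mat[OF A mB(1) s(1)])
  have BM: "B * M = s"
    unfolding M_def using B(1) mB s by (simp flip: assoc_mult_mat[of _ k k _ k _ k])
  have zs: "(A * M) @\<^sub>r s = (A @\<^sub>r B) * M"
    using append_rows_mult[OF A B(1) M] BM by simp
  have "g * ((A * M) @\<^sub>r s) = (A' @\<^sub>r B') * P"
    unfolding zs P_def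
    using assoc_mult_mat[of g "k + k" "k + k" "A @\<^sub>r B" k M k] assoc_mult_mat[of "A' @\<^sub>r B'" "k + k" k L k M k]
      g A B A' B' M L eq by simp
  also have "\<dots> = (A' * P) @\<^sub>r (B' * P)"
    by (rule append_rows_mult[OF A' B'(1) P])
  finally have gz: "g * ((A * M) @\<^sub>r s) = (A' * P) @\<^sub>r (B' * P)" .
  have c: "A * M \<in> carrier_mat k k" "A' * P \<in> carrier_mat k k" "B' * P \<in> carrier_mat k k"
    using A A' B' M P by auto
  note ae = act_eq[OF g c(1) s(1) gz c(2,3)]
  have dM: "det M = det s / det B"
    unfolding M_def using det_mult[OF mB(1) s(1)] det_minv[OF B] by simp
  have dBP: "det (B' * P) = det B' * (det L * det M)"
    using det_mult[OF B'(1) P] det_mult[OF L(1) M] by (simp add: P_def)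
  have nz: "det (B' * P) \<noteq> 0"
    using dBP dM B' L B s by simp
  note mBP = minv[OF c(3) nz]
  \<comment> \<open>Inserting \<open>minv B' * B'\<close> makes \<open>B' * P\<close> meet its
    inverse, so \<open>P\<close> cancels from the image point.\<close>
  have "P * minv (B' * P) = minv B' * B' * (P * minv (B' * P))"
    using mB' P mBP by simp
  also have "\<dots> = minv B' * (B' * P * minv (B' * P))"
    using mB'(1) B'(1) P mBP(1) by (simp add: assoc_mult_mat[of _ k k _ k _ k])
  also have "\<dots> = minv B'" using mB' mBP by simp
  finally have "P * minv (B' * P) = minv B'" .
  moreover have "A' * P * minv (B' * P) = A' * (P * minv (B' * P))"
    by (rule assoc_mult_mat[OF A' P mBP(1)])
  ultimately show "act s g (A * minv B * s) = A' * minv B' * s"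
    using ae z by simp
  show "autom s g (A * minv B * s) * det B = det L * det B'"
    unfolding autom_def z ae(2)
    using det_mult[OF ms(1) c(3)] det_minv[OF s] dBP dM B s by simp
qed

subsection \<open>Block matrices of shape \<open>4 \<times> 4\<close>\<close>

lemma block4_carrier:
  assumes "a11 \<in> carrier_mat t t" "a22 \<in> carrier_mat r r" "a33 \<in> carrier_mat r r" "a44 \<in> carrier_mat t t"
  shows "block4 a11 a12 a13 a14 a21 a22 a23 a24 a31 a32 a33 a34 a41 a42 a43 a44
    \<in> carrier_mat ((t + r) + (t + r)) ((t + r) + (t + r))"
  using assms by (auto simp: block4_def)

text \<open>Block sizes are \<open>t, r, r, t\<close>, so the outer halves have sizes
  \<open>t + r\<close> and \<open>r + t\<close>. Each quadrant of the product is a sum of two inner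
  block products, whence the bracketing of the four-term sums. As a rewrite rule it turns identities
  between constant block matrices into identities between their blocks.\<close>

lemma block4_mult:
  assumes "a11 \<in> carrier_mat t t" "a12 \<in> carrier_mat t r" "a13 \<in> carrier_mat t r" "a14 \<in> carrier_mat t t"
    "a21 \<in> carrier_mat r t" "a22 \<in> carrier_mat r r" "a23 \<in> carrier_mat r r" "a24 \<in> carrier_mat r t"
    "a31 \<in> carrier_mat r t" "a32 \<in> carrier_mat r r" "a33 \<in> carrier_mat r r" "a34 \<in> carrier_mat r t"
    "a41 \<in> carrier_mat t t" "a42 \<in> carrier_mat t r" "a43 \<in> carrier_mat t r" "a44 \<in> carrier_mat t t"
    "b11 \<in> carrier_mat t t" "b12 \<in> carrier_mat t r" "b13 \<in> carrier_mat t r" "b14 \<in> carrier_mat t t"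
    "b21 \<in> carrier_mat r t" "b22 \<in> carrier_mat r r" "b23 \<in> carrier_mat r r" "b24 \<in> carrier_mat r t"
    "b31 \<in> carrier_mat r t" "b32 \<in> carrier_mat r r" "b33 \<in> carrier_mat r r" "b34 \<in> carrier_mat r t"
    "b41 \<in> carrier_mat t t" "b42 \<in> carrier_mat t r" "b43 \<in> carrier_mat t r" "b44 \<in> carrier_mat t t"
  shows "block4 a11 a12 a13 a14 a21 a22 a23 a24 a31 a32 a33 a34 a41 a42 a43 a44
      * block4 b11 b12 b13 b14 b21 b22 b23 b24 b31 b32 b33 b34 b41 b42 b43 b44
    = block4
     ((a11 * b11 + a12 * b21) + (a13 * b31 + a14 * b41)) ((a11 * b12 + a12 * b22) + (a13 * b32 + a14 * b42))
     ((a11 * b13 + a12 * b23) + (a13 * b33 + a14 * b43)) ((a11 * b14 + a12 * b24) + (a13 * b34 + a14 * b44))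
     ((a21 * b11 + a22 * b21) + (a23 * b31 + a24 * b41)) ((a21 * b12 + a22 * b22) + (a23 * b32 + a24 * b42))
     ((a21 * b13 + a22 * b23) + (a23 * b33 + a24 * b43)) ((a21 * b14 + a22 * b24) + (a23 * b34 + a24 * b44))
     ((a31 * b11 + a32 * b21) + (a33 * b31 + a34 * b41)) ((a31 * b12 + a32 * b22) + (a33 * b32 + a34 * b42))
     ((a31 * b13 + a32 * b23) + (a33 * b33 + a34 * b43)) ((a31 * b14 + a32 * b24) + (a33 * b34 + a34 * b44))
     ((a41 * b11 + a42 * b21) + (a43 * b31 + a44 * b41)) ((a41 * b12 + a42 * b22) + (a43 * b32 + a44 * b42))
     ((a41 * b13 + a42 * b23) + (a43 * b33 + a44 * b43)) ((a41 * b14 + a42 * b24) + (a43 * b34 + a44 * (b44 :: complex mat)))"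
  unfolding block4_def
  apply (subst mult_four_block_mat[of _ "t + r" "t + r" _ "r + t" _ "r + t" _ _ "t + r" _ "r + t"])
         apply ((rule four_block_carrier_mat; fact)+)
  apply (intro cong_four_block_mat)
  subgoal by (subst mult_four_block_mat[of _ t t _ r _ r _ _ t _ r], fact+, subst mult_four_block_mat[of _ t r _ t _ r _ _ t _ r], fact+, subst add_four_block_mat[of _ t t _ r _ r]) (use assms in auto)
  subgoal by (subst mult_four_block_mat[of _ t t _ r _ r _ _ r _ t], fact+, subst mult_four_block_mat[of _ t r _ t _ r _ _ r _ t], fact+, subst add_four_block_mat[of _ t r _ t _ r]) (use assms in auto)
  subgoal by (subst mult_four_block_mat[of _ r t _ r _ t _ _ t _ r], fact+, subst mult_four_block_mat[of _ r r _ t _ t _ _ t _ r], fact+, subst add_four_block_mat[of _ r t _ r _ t]) (use assms in auto)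
  subgoal by (subst mult_four_block_mat[of _ r t _ r _ t _ _ r _ t], fact+, subst mult_four_block_mat[of _ r r _ t _ t _ _ r _ t], fact+, subst add_four_block_mat[of _ r r _ t _ t]) (use assms in auto)
  done

lemma block4_adjoint:
  assumes "a11 \<in> carrier_mat t t" "a12 \<in> carrier_mat t r" "a13 \<in> carrier_mat t r" "a14 \<in> carrier_mat t t"
    "a21 \<in> carrier_mat r t" "a22 \<in> carrier_mat r r" "a23 \<in> carrier_mat r r" "a24 \<in> carrier_mat r t"
    "a31 \<in> carrier_mat r t" "a32 \<in> carrier_mat r r" "a33 \<in> carrier_mat r r" "a34 \<in> carrier_mat r t"
    "a41 \<in> carrier_mat t t" "a42 \<in> carrier_mat t r" "a43 \<in> carrier_mat t r" "a44 \<in> carrier_mat t t"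
  shows "mat_adjoint (block4 a11 a12 a13 a14 a21 a22 a23 a24 a31 a32 a33 a34 a41 a42 a43 a44) =
    block4 (mat_adjoint a11) (mat_adjoint a21) (mat_adjoint a31) (mat_adjoint a41)
      (mat_adjoint a12) (mat_adjoint a22) (mat_adjoint a32) (mat_adjoint a42)
      (mat_adjoint a13) (mat_adjoint a23) (mat_adjoint a33) (mat_adjoint a43)
      (mat_adjoint a14) (mat_adjoint a24) (mat_adjoint a34) (mat_adjoint a44)"
  unfolding block4_def using assms
  by (simp add: mat_adjoint_four_block_mat[of _ "t + r" "t + r" _ "r + t" _ "r + t"]
    mat_adjoint_four_block_mat[of _ t t _ r _ r] mat_adjoint_four_block_mat[of _ t r _ t _ r]
    mat_adjoint_four_block_mat[of _ r t _ r _ t] mat_adjoint_four_block_mat[of _ r r _ t _ t])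

lemma block4_cnj:
  assumes "a11 \<in> carrier_mat t t" "a12 \<in> carrier_mat t r" "a13 \<in> carrier_mat t r" "a14 \<in> carrier_mat t t"
    "a21 \<in> carrier_mat r t" "a22 \<in> carrier_mat r r" "a23 \<in> carrier_mat r r" "a24 \<in> carrier_mat r t"
    "a31 \<in> carrier_mat r t" "a32 \<in> carrier_mat r r" "a33 \<in> carrier_mat r r" "a34 \<in> carrier_mat r t"
    "a41 \<in> carrier_mat t t" "a42 \<in> carrier_mat t r" "a43 \<in> carrier_mat t r" "a44 \<in> carrier_mat t t"
  shows "mat_cnj (block4 a11 a12 a13 a14 a21 a22 a23 a24 a31 a32 a33 a34 a41 a42 a43 a44) =
    block4 (mat_cnj a11) (mat_cnj a12) (mat_cnj a13) (mat_cnj a14)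
      (mat_cnj a21) (mat_cnj a22) (mat_cnj a23) (mat_cnj a24)
      (mat_cnj a31) (mat_cnj a32) (mat_cnj a33) (mat_cnj a34)
      (mat_cnj a41) (mat_cnj a42) (mat_cnj a43) (mat_cnj a44)"
  unfolding block4_def using assms
  by (simp add: map_four_block_mat[of _ "t + r" "t + r" _ "r + t" _ "r + t"]
    map_four_block_mat[of _ t t _ r _ r] map_four_block_mat[of _ t r _ t _ r]
    map_four_block_mat[of _ r t _ r _ t] map_four_block_mat[of _ r r _ t _ t])

lemma block4_uminus:
  assumes "a11 \<in> carrier_mat t t" "a12 \<in> carrier_mat t r" "a13 \<in> carrier_mat t r" "a14 \<in> carrier_mat t t"
    "a21 \<in> carrier_mat r t" "a22 \<in> carrier_mat r r" "a23 \<in> carrier_mat r r" "a24 \<in> carrier_mat r t"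
    "a31 \<in> carrier_mat r t" "a32 \<in> carrier_mat r r" "a33 \<in> carrier_mat r r" "a34 \<in> carrier_mat r t"
    "a41 \<in> carrier_mat t t" "a42 \<in> carrier_mat t r" "a43 \<in> carrier_mat t r" "a44 \<in> carrier_mat t t"
  shows "- (block4 a11 a12 a13 a14 a21 a22 a23 a24 a31 a32 a33 a34 a41 a42 a43 a44) =
    block4 (- a11) (- a12) (- a13) (- a14) (- a21) (- a22) (- a23) (- a24)
      (- a31) (- a32) (- a33) (- a34) (- a41) (- a42) (- a43) (- a44 :: complex mat)"
  unfolding block4_def using assms by (intro eq_matI) auto

lemma block4_add:
  assumes "a11 \<in> carrier_mat t t" "a12 \<in> carrier_mat t r" "a13 \<in> carrier_mat t r" "a14 \<in> carrier_mat t t"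
    "a21 \<in> carrier_mat r t" "a22 \<in> carrier_mat r r" "a23 \<in> carrier_mat r r" "a24 \<in> carrier_mat r t"
    "a31 \<in> carrier_mat r t" "a32 \<in> carrier_mat r r" "a33 \<in> carrier_mat r r" "a34 \<in> carrier_mat r t"
    "a41 \<in> carrier_mat t t" "a42 \<in> carrier_mat t r" "a43 \<in> carrier_mat t r" "a44 \<in> carrier_mat t t"
    "b11 \<in> carrier_mat t t" "b12 \<in> carrier_mat t r" "b13 \<in> carrier_mat t r" "b14 \<in> carrier_mat t t"
    "b21 \<in> carrier_mat r t" "b22 \<in> carrier_mat r r" "b23 \<in> carrier_mat r r" "b24 \<in> carrier_mat r t"
    "b31 \<in> carrier_mat r t" "b32 \<in> carrier_mat r r" "b33 \<in> carrier_mat r r" "b34 \<in> carrier_mat r t"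
    "b41 \<in> carrier_mat t t" "b42 \<in> carrier_mat t r" "b43 \<in> carrier_mat t r" "b44 \<in> carrier_mat t t"
  shows "block4 a11 a12 a13 a14 a21 a22 a23 a24 a31 a32 a33 a34 a41 a42 a43 a44
      + block4 b11 b12 b13 b14 b21 b22 b23 b24 b31 b32 b33 b34 b41 b42 b43 b44
    = block4 (a11 + b11) (a12 + b12) (a13 + b13) (a14 + b14) (a21 + b21) (a22 + b22) (a23 + b23) (a24 + b24)
     (a31 + b31) (a32 + b32) (a33 + b33) (a34 + b34) (a41 + b41) (a42 + b42) (a43 + b43) (a44 + b44 :: complex mat)"
  unfolding block4_def using assms
  by (simp add: add_four_block_mat[of _ "t + r" "t + r" _ "r + t" _ "r + t"]
    add_four_block_mat[of _ t t _ r _ r] add_four_block_mat[of _ t r _ t _ r]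
    add_four_block_mat[of _ r t _ r _ t] add_four_block_mat[of _ r r _ t _ t])

text \<open>Used from right to left, like \<open>block4_zero\<close>, to bring the right side of a
  constant identity into block shape.\<close>

lemma block4_one:
  "block4 (1\<^sub>m t) (0\<^sub>m t r) (0\<^sub>m t r) (0\<^sub>m t t) (0\<^sub>m r t) (1\<^sub>m r) (0\<^sub>m r r) (0\<^sub>m r t)
    (0\<^sub>m r t) (0\<^sub>m r r) (1\<^sub>m r) (0\<^sub>m r t) (0\<^sub>m t t) (0\<^sub>m t r) (0\<^sub>m t r) (1\<^sub>m t :: complex mat)
    = 1\<^sub>m ((t + r) + (t + r))"
  by (simp add: block4_def add.commute[of r t])

lemma block4_zero:
  "block4 (0\<^sub>m t t) (0\<^sub>m t r) (0\<^sub>m t r) (0\<^sub>m t t) (0\<^sub>m r t) (0\<^sub>m r r) (0\<^sub>m r r) (0\<^sub>m r t)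
    (0\<^sub>m r t) (0\<^sub>m r r) (0\<^sub>m r r) (0\<^sub>m r t) (0\<^sub>m t t) (0\<^sub>m t r) (0\<^sub>m t r) (0\<^sub>m t t :: complex mat)
    = 0\<^sub>m ((t + r) + (t + r)) ((t + r) + (t + r))"
  by (simp add: block4_def add.commute[of r t])

subsection \<open>The constant matrices\<close>

lemma J2_eq: "J2 = mat 2 2 (\<lambda>(i, j). if i = 0 \<and> j = 1 then -1 else if i = 1 \<and> j = 0 then 1 else 0)"
  by (rule eq_matI) (auto simp: J2_def mat_of_rows_list_def less_2_cases_iff)

lemma J2_carrier: "J2 \<in> carrier_mat 2 2"
  by (simp add: J2_eq)

text \<open>Splitting off one \<open>2 \<times> 2\<close> block drives the inductions that transfer
  the properties of \<open>J2\<close> to \<open>Jm\<close>.\<close>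

lemma Jm_Suc: "Jm (Suc m) = diag_block_mat [J2, Jm m]"
  unfolding Jm_def replicate_Suc diag_block_mat_two unfolding diag_block_mat.simps(2) Let_def ..

lemma Jm_carrier [simp]: "Jm m \<in> carrier_mat (2 * m) (2 * m)"
proof (induction m)
  case (Suc m)
  then show ?case
    using diag_block_mat_two_carrier[OF J2_carrier Suc] by (simp only: Jm_Suc mult_Suc_right)
qed (simp add: Jm_def)

lemma J2_adjoint: "mat_adjoint J2 = - J2"
  by (rule eq_matI) (auto simp: J2_eq)

lemma J2_square: "J2 * J2 = - 1\<^sub>m 2"
  by (rule eq_matI) (auto simp: J2_eq scalar_prod_def numeral_2_eq_2 less_Suc_eq)

lemma J2_cnj: "mat_cnj J2 = J2"
  by (rule eq_matI) (auto simp: J2_eq)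

lemma Jm_adjoint [simp]: "mat_adjoint (Jm m) = - Jm m"
proof (induction m)
  case 0
  show ?case by (rule eq_matI) (auto simp: Jm_def)
next
  case (Suc m)
  have "diag_block_mat [- J2, - Jm m] = - diag_block_mat [J2, Jm m]"
    by (rule eq_matI) (auto simp: diag_block_mat_two)
  then show ?case
    using Suc by (simp only: Jm_Suc mat_adjoint_diag_block_mat_two J2_adjoint)
qed

lemma Jm_square [simp]: "Jm m * Jm m = - 1\<^sub>m (2 * m)"
proof (induction m)
  case 0
  show ?case by (rule eq_matI) (auto simp: Jm_def)
next
  case (Suc m)
  have "Jm (Suc m) * Jm (Suc m) = diag_block_mat [- 1\<^sub>m 2, - 1\<^sub>m (2 * m)]"
    unfolding Jm_Suc
    using diag_block_mat_two_mult[OF J2_carrier Jm_carrier J2_carrier Jm_carrier] Suc J2_square by metis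
  also have "\<dots> = - 1\<^sub>m (2 * Suc m)"
    by (rule eq_matI) (auto simp: diag_block_mat_two)
  finally show ?case .
qed

lemma Jm_cnj [simp]: "mat_cnj (Jm m) = Jm m"
proof (induction m)
  case 0
  show ?case by (rule eq_matI) (auto simp: Jm_def)
next
  case (Suc m)
  have "mat_cnj (diag_block_mat [J2, Jm m]) = diag_block_mat [mat_cnj J2, mat_cnj (Jm m)]"
    by (rule eq_matI) (auto simp: diag_block_mat_two)
  with Suc show ?case by (simp only: Jm_Suc J2_cnj)
qed

lemma Jm_dim [simp]: "dim_row (Jm m) = 2 * m" "dim_col (Jm m) = 2 * m"
  using Jm_carrier[of m] by (auto simp del: Jm_carrier)

lemma Jm_mult_simps [simp]:
  "1\<^sub>m (2 * m) * Jm m = Jm m" "Jm m * 1\<^sub>m (2 * m) = Jm m"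
  "0\<^sub>m a (2 * m) * Jm m = 0\<^sub>m a (2 * m)" "Jm m * 0\<^sub>m (2 * m) a = 0\<^sub>m (2 * m) a"
  "Jm m + 0\<^sub>m (2 * m) (2 * m) = Jm m" "0\<^sub>m (2 * m) (2 * m) + Jm m = Jm m"
  "- (- Jm m) = Jm m"
  by (simp_all add: left_mult_one_mat[OF Jm_carrier] right_mult_one_mat[OF Jm_carrier]
    left_mult_zero_mat[OF Jm_carrier] right_mult_zero_mat[OF Jm_carrier]
    right_add_zero_mat[OF Jm_carrier] left_add_zero_mat[OF Jm_carrier] uminus_uminus_mat)

lemma phi_carrier: "phi_inf m r \<in> carrier_mat (dim_n m r + dim_n m r) (dim_n m r + dim_n m r)"
  unfolding phi_inf_def Let_def by (rule block4_carrier) auto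

lemma psi_carrier: "psi_inf m r \<in> carrier_mat (dim_n m r + dim_n m r) (dim_n m r + dim_n m r)"
  unfolding psi_inf_def Let_def by (rule block4_carrier) auto

lemma frak_J_carrier: "frak_J m r \<in> carrier_mat (dim_n m r + dim_n m r) (dim_n m r + dim_n m r)"
  unfolding frak_J_def Let_def by (rule block4_carrier) auto

lemma psi_cnj: "mat_cnj (psi_inf m r) = psi_inf m r"
  unfolding psi_inf_def Let_def by (simp add: block4_cnj[where t = "2 * m" and r = r])

lemma phi_phi: "phi_inf m r * phi_inf m r = - 1\<^sub>m (dim_n m r + dim_n m r)"
  unfolding phi_inf_def Let_def block4_one[of "2 * m" r, symmetric]
  by (simp add: block4_mult[where t = "2 * m" and r = r] block4_uminus[where t = "2 * m" and r = r])

text \<open>Ties the hermitian and the bilinear form together: preserving both means commuting with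
  the antilinear map that sends \<open>x\<close> to \<open>frak_J\<close> times the conjugate of
  \<open>x\<close>.\<close>

lemma phi_psi: "phi_inf m r * psi_inf m r = frak_J m r"
  unfolding phi_inf_def psi_inf_def frak_J_def Let_def
  by (simp add: block4_mult[where t = "2 * m" and r = r] uminus_mult_left_mat)

text \<open>Comes down to \<open>Jm\<close> being skew-adjoint with square \<open>-1\<close>. It
  removes \<open>frak_J\<close> from the second frame when the form is evaluated.\<close>

lemma frak_J_phi_frak_J: "mat_adjoint (frak_J m r) * phi_inf m r * frak_J m r = phi_inf m r"
  unfolding phi_inf_def frak_J_def Let_def
  by (simp add: block4_mult[where t = "2 * m" and r = r] block4_adjoint[where t = "2 * m" and r = r])

section \<open>The doubling matrix \<open>R_mat\<close>, the base matrix \<open>u0\<close> and the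
  matrix \<open>S_mat\<close>\<close>

lemma R_carrier: "R_mat m r \<in> carrier_mat (dim_N m r + dim_N m r) (dim_N m r + dim_N m r)"
proof -
  have "dim_N m r = (2 * m + r) + (2 * m + r)" by simp
  then show ?thesis
    unfolding R_mat_def Let_def by (simp only:) (intro four_block_carrier_mat block4_carrier; simp)
qed

lemma J_N_carrier: "J_N m r \<in> carrier_mat (dim_N m r + dim_N m r) (dim_N m r + dim_N m r)"
  unfolding J_N_def Let_def by (intro four_block_carrier_mat zero_carrier_mat)

text \<open>Checked on the four quadrants of \<open>R_mat\<close>. It both computes the form on
  doubled frames and yields the invertibility of \<open>R_mat\<close>.\<close>

lemma R_form:
  "mat_adjoint (R_mat m r) * diag_block_mat [phi_inf m r, - phi_inf m r] * R_mat m r = J_N m r"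
proof -
  define k where "k = 2 * m + r + (2 * m + r)"
  have k: "dim_N m r = k" by (simp add: k_def)
  obtain a b c d where abcd: "R_mat m r = four_block_mat a b c d" and
    a: "a = block4 (1\<^sub>m (2*m)) (0\<^sub>m (2*m) r) (0\<^sub>m (2*m) r) (0\<^sub>m (2*m) (2*m))
             (0\<^sub>m r (2*m)) ((1/2) \<cdot>\<^sub>m 1\<^sub>m r) (0\<^sub>m r r) (0\<^sub>m r (2*m))
             (0\<^sub>m r (2*m)) (0\<^sub>m r r) ((1/2) \<cdot>\<^sub>m 1\<^sub>m r) (0\<^sub>m r (2*m))
             (0\<^sub>m (2*m) (2*m)) (0\<^sub>m (2*m) r) (0\<^sub>m (2*m) r) (0\<^sub>m (2*m) (2*m))" and
    b: "b = block4 (0\<^sub>m (2*m) (2*m)) (0\<^sub>m (2*m) r) (0\<^sub>m (2*m) r) (0\<^sub>m (2*m) (2*m))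
             (0\<^sub>m r (2*m)) (0\<^sub>m r r) (- 1\<^sub>m r) (0\<^sub>m r (2*m))
             (0\<^sub>m r (2*m)) (1\<^sub>m r) (0\<^sub>m r r) (0\<^sub>m r (2*m))
             (1\<^sub>m (2*m)) (0\<^sub>m (2*m) r) (0\<^sub>m (2*m) r) (0\<^sub>m (2*m) (2*m))" and
    c: "c = block4 (0\<^sub>m (2*m) (2*m)) (0\<^sub>m (2*m) r) (0\<^sub>m (2*m) r) (- 1\<^sub>m (2*m))
             (0\<^sub>m r (2*m)) (- ((1/2) \<cdot>\<^sub>m 1\<^sub>m r)) (0\<^sub>m r r) (0\<^sub>m r (2*m))
             (0\<^sub>m r (2*m)) (0\<^sub>m r r) (- ((1/2) \<cdot>\<^sub>m 1\<^sub>m r)) (0\<^sub>m r (2*m))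
             (0\<^sub>m (2*m) (2*m)) (0\<^sub>m (2*m) r) (0\<^sub>m (2*m) r) (0\<^sub>m (2*m) (2*m))" and
    d: "d = block4 (0\<^sub>m (2*m) (2*m)) (0\<^sub>m (2*m) r) (0\<^sub>m (2*m) r) (0\<^sub>m (2*m) (2*m))
             (0\<^sub>m r (2*m)) (0\<^sub>m r r) (- 1\<^sub>m r) (0\<^sub>m r (2*m))
             (0\<^sub>m r (2*m)) (1\<^sub>m r) (0\<^sub>m r r) (0\<^sub>m r (2*m))
             (0\<^sub>m (2*m) (2*m)) (0\<^sub>m (2*m) r) (0\<^sub>m (2*m) r) (1\<^sub>m (2*m))"
    by (simp only: R_mat_def Let_def)
  have cr: "a \<in> carrier_mat k k" "b \<in> carrier_mat k k" "c \<in> carrier_mat k k" "d \<in> carrier_mat k k"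
      "phi_inf m r \<in> carrier_mat k k"
    unfolding a b c d k_def by (rule block4_carrier phi_carrier; simp)+
  let ?f = "phi_inf m r"
  \<comment> \<open>In the two diagonal quadrants the contributions of \<open>phi_inf\<close> and
    \<open>- phi_inf\<close> cancel, as quarters in the first and as units in the last. In the mixed
    quadrants two halves add up to a unit.\<close>
  have half: "(1/2) \<cdot>\<^sub>m 1\<^sub>m r + (1/2) \<cdot>\<^sub>m 1\<^sub>m r = (1\<^sub>m r :: complex mat)"
    "- ((1/2) \<cdot>\<^sub>m 1\<^sub>m r) + - ((1/2) \<cdot>\<^sub>m 1\<^sub>m r) = (- 1\<^sub>m r :: complex mat)"
    "(1/2) \<cdot>\<^sub>m 1\<^sub>m r * ((1/2) \<cdot>\<^sub>m 1\<^sub>m r) = ((1/4) \<cdot>\<^sub>m 1\<^sub>m r :: complex mat)"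
    "(1/4) \<cdot>\<^sub>m 1\<^sub>m r + - ((1/4) \<cdot>\<^sub>m 1\<^sub>m r) = (0\<^sub>m r r :: complex mat)"
    "- ((1/4) \<cdot>\<^sub>m 1\<^sub>m r) + (1/4) \<cdot>\<^sub>m 1\<^sub>m r = (0\<^sub>m r r :: complex mat)"
    "1\<^sub>m r + - 1\<^sub>m r = (0\<^sub>m r r :: complex mat)" "- 1\<^sub>m r + 1\<^sub>m r = (0\<^sub>m r r :: complex mat)"
    by (auto intro!: eq_matI)
  note blocks = block4_mult[where t = "2 * m" and r = r] block4_adjoint[where t = "2 * m" and r = r]
    block4_add[where t = "2 * m" and r = r] block4_uminus[where t = "2 * m" and r = r]
  have q: "mat_adjoint a * (?f * a) + mat_adjoint c * (- ?f * c) = 0\<^sub>m k k"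
    "mat_adjoint a * (?f * b) + mat_adjoint c * (- ?f * d) = - 1\<^sub>m k"
    "mat_adjoint b * (?f * a) + mat_adjoint d * (- ?f * c) = 1\<^sub>m k"
    "mat_adjoint b * (?f * b) + mat_adjoint d * (- ?f * d) = 0\<^sub>m k k"
    unfolding a b c d phi_inf_def Let_def k_def
      block4_one[of "2 * m" r, symmetric] block4_zero[of "2 * m" r, symmetric]
    by (simp_all add: blocks half)
  have D: "diag_block_mat [?f, - ?f] = four_block_mat ?f (0\<^sub>m k k) (0\<^sub>m k k) (- ?f)"
    using cr by (simp add: diag_block_mat_two del: diag_block_mat.simps)
  have DR: "diag_block_mat [?f, - ?f] * R_mat m r = four_block_mat (?f * a) (?f * b) (- ?f * c) (- ?f * d)"
    unfolding D abcd using cr by (subst mult_four_block_mat[of _ k k _ k _ k _ _ k _ k]) auto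
  have R: "mat_adjoint (R_mat m r) = four_block_mat (mat_adjoint a) (mat_adjoint c) (mat_adjoint b) (mat_adjoint d)"
    unfolding abcd using cr by (subst mat_adjoint_four_block_mat[of _ k k _ k _ k]) auto
  have "mat_adjoint (R_mat m r) * (diag_block_mat [?f, - ?f] * R_mat m r) =
    four_block_mat (mat_adjoint a * (?f * a) + mat_adjoint c * (- ?f * c))
      (mat_adjoint a * (?f * b) + mat_adjoint c * (- ?f * d))
      (mat_adjoint b * (?f * a) + mat_adjoint d * (- ?f * c))
      (mat_adjoint b * (?f * b) + mat_adjoint d * (- ?f * d))"
    unfolding DR R by (rule mult_four_block_mat[of _ k k _ k _ k _ _ k _ k]) (use cr in auto)
  also have "\<dots> = four_block_mat (0\<^sub>m k k) (- 1\<^sub>m k) (1\<^sub>m k) (0\<^sub>m k k)"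
    unfolding q ..
  finally have "mat_adjoint (R_mat m r) * (diag_block_mat [?f, - ?f] * R_mat m r) =
    four_block_mat (0\<^sub>m k k) (- 1\<^sub>m k) (1\<^sub>m k) (0\<^sub>m k k)" .
  moreover have "mat_adjoint (R_mat m r) * (diag_block_mat [?f, - ?f] * R_mat m r) =
      mat_adjoint (R_mat m r) * diag_block_mat [?f, - ?f] * R_mat m r"
    by (rule assoc_mult_mat[OF mat_adjoint_carrier[OF R_carrier[of m r, unfolded k]] _ R_carrier[of m r, unfolded k], symmetric])
      (use cr in \<open>auto simp: D\<close>)
  ultimately show ?thesis
    by (simp only: J_N_def Let_def k)
qed

text \<open>The upper right block is minus the adjoint of \<open>u0\<close>. In this form the
  results on off-diagonal forms apply to \<open>phi_inf\<close>.\<close>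

lemma phi_off_diagonal:
  "phi_inf m r = four_block_mat (0\<^sub>m (dim_n m r) (dim_n m r))
    (four_block_mat (0\<^sub>m (2 * m) r) (- 1\<^sub>m (2 * m)) (- 1\<^sub>m r) (0\<^sub>m r (2 * m)))
    (u0 m r) (0\<^sub>m (dim_n m r) (dim_n m r))"
  by (simp add: phi_inf_def block4_def u0_def Let_def add.commute[of r])

lemma u0_carrier: "u0 m r \<in> carrier_mat (dim_n m r) (dim_n m r)"
  by (auto simp: u0_def)

lemma u0_adjoint_mult: "mat_adjoint (u0 m r) * u0 m r = 1\<^sub>m (dim_n m r)"
proof -
  have "mat_adjoint (u0 m r) = four_block_mat (0\<^sub>m (2 * m) r) (1\<^sub>m (2 * m)) (1\<^sub>m r) (0\<^sub>m r (2 * m))"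
    unfolding u0_def by (subst mat_adjoint_four_block_mat[of _ r "2 * m" _ r _ "2 * m"]) auto
  then show ?thesis
    unfolding u0_def
    by (simp add: mult_four_block_mat[of _ "2 * m" r _ "2 * m" _ r _ _ "2 * m" _ r])
qed

lemma u0_det: "det (u0 m r) \<noteq> 0"
  using det_mult[of "mat_adjoint (u0 m r)" "dim_n m r" "u0 m r"] u0_adjoint_mult[of m r] u0_carrier[of m r] by auto

lemma det_diag_block_mat:
  "(\<And>A. A \<in> set As \<Longrightarrow> square_mat A) \<Longrightarrow> det (diag_block_mat As :: complex mat) = prod_list (map det As)"
proof (induction As)
  case (Cons A As)
  have "square_mat (diag_block_mat As)"
    using Cons.prems by (intro diag_block_mat_square) auto
  moreover have "square_mat A" using Cons.prems by auto
  ultimately have "det (diag_block_mat (A # As)) = det A * det (diag_block_mat As)"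
    by (auto simp: Let_def intro!: det_four_block_mat_upper_right_zero[of _ "dim_row A" _ "dim_row (diag_block_mat As)"])
  then show ?case using Cons by simp
qed simp

lemma S_det: "det (S_mat m r) \<noteq> 0"
  unfolding S_mat_def by (subst det_diag_block_mat) auto

lemma S_carrier: "S_mat m r \<in> carrier_mat (dim_N m r) (dim_N m r)"
  by (rule carrier_matI) (simp_all add: S_mat_def dim_diag_block_mat del: diag_block_mat.simps)

subsection \<open>Doubled frames\<close>

lemma uminus_mat_eq_smult: "- A = (- 1) \<cdot>\<^sub>m (A :: complex mat)"
  by (rule eq_matI) auto

lemma mult_smult_minus_mult:
  assumes B: "(B :: complex mat) \<in> carrier_mat a b" and P: "P \<in> carrier_mat b c" and Q: "Q \<in> carrier_mat b c"
    and D: "D \<in> carrier_mat c d"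
  shows "B * (k \<cdot>\<^sub>m (P - Q)) * D = k \<cdot>\<^sub>m (B * P * D - B * Q * D)"
proof -
  have PQ: "P - Q \<in> carrier_mat b c" using P Q by auto
  have BP: "B * P \<in> carrier_mat a c" and BQ: "B * Q \<in> carrier_mat a c" using B P Q by auto
  have "B * P - B * Q \<in> carrier_mat a c" by (rule minus_carrier_mat[OF BQ])
  from mult_smult_assoc_mat[OF this D, of k] show ?thesis
    unfolding mult_smult_distrib[OF B PQ] mult_minus_distrib_mat[OF B P Q] minus_mult_distrib_mat[OF BP BQ D] .
qed

text \<open>Conjugation exchanges \<open>-\<i>\<close> and \<open>\<i>\<close>, which absorbs the
  sign of the second form \<open>- phi_inf\<close>. This is why conjugating the second frame makes
  the doubled form positive.\<close>

lemma smult_diag_block_mat_cnj: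
  "(- \<i>) \<cdot>\<^sub>m diag_block_mat [A, - mat_cnj B] = diag_block_mat [(- \<i>) \<cdot>\<^sub>m A, mat_cnj ((- \<i>) \<cdot>\<^sub>m B)]"
  unfolding diag_block_mat_two by (rule eq_matI) auto

lemma U_carrier [simp]: "z \<in> carrier_mat (dim_n m r) (dim_n m r) \<Longrightarrow>
  U_mat m r z \<in> carrier_mat (dim_n m r + dim_n m r) (dim_n m r)"
  unfolding U_mat_def by (intro carrier_append_rows u0_carrier)

text \<open>By \<open>R_form\<close>, a singular \<open>R_mat\<close> would make \<open>J_N\<close>
  singular, but \<open>J_N\<close> has square \<open>-1\<close>.\<close>

lemma R_det: "det (R_mat m r) \<noteq> 0"
proof
  assume 0: "det (R_mat m r) = 0"
  let ?N = "dim_N m r" and ?R = "R_mat m r" and ?D = "diag_block_mat [phi_inf m r, - phi_inf m r]"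
  have D: "?D \<in> carrier_mat (?N + ?N) (?N + ?N)"
  proof -
    have N: "?N = dim_n m r + dim_n m r" by (rule mult_2)
    show ?thesis
      unfolding N by (intro diag_block_mat_two_carrier uminus_carrier_mat phi_carrier)
  qed
  have R: "?R \<in> carrier_mat (?N + ?N) (?N + ?N)" by (rule R_carrier)
  have J: "J_N m r \<in> carrier_mat (?N + ?N) (?N + ?N)" by (rule J_N_carrier)
  have "det (J_N m r) = det (mat_adjoint ?R * ?D) * det ?R"
    unfolding R_form[symmetric] by (rule det_mult[OF mult_carrier_mat[OF mat_adjoint_carrier[OF R] D] R])
  then have "det (J_N m r) = 0" using 0 by simp
  moreover have "J_N m r * J_N m r = - 1\<^sub>m (?N + ?N)"
  proof -
    have "J_N m r * J_N m r = four_block_mat (- 1\<^sub>m ?N) (0\<^sub>m ?N ?N) (0\<^sub>m ?N ?N) (- 1\<^sub>m ?N)"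
      unfolding J_N_def Let_def by (subst mult_four_block_mat[of _ ?N ?N _ ?N _ ?N _ _ ?N _ ?N]) auto
    also have "\<dots> = - 1\<^sub>m (?N + ?N)" by (rule eq_matI) auto
    finally show ?thesis .
  qed
  moreover have "det (- 1\<^sub>m (?N + ?N) :: complex mat) \<noteq> 0"
    unfolding uminus_mat_eq_smult by simp
  ultimately show False
    using det_mult[OF J J] by simp
qed

text \<open>From \<open>g^* f g = f\<close> and \<open>f f = -1\<close> the inverse of
  \<open>g\<close> is \<open>- f g^* f\<close>, hence also \<open>g f g^* = f\<close>. Then
  \<open>g f p = g f g^* p cnj(g) = f p cnj(g)\<close>.\<close>

lemma intertwine_conjugate:
  assumes g: "g \<in> carrier_mat k k" and f: "f \<in> carrier_mat k k" and p: "p \<in> carrier_mat k k"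
    and ff: "f * f = - 1\<^sub>m k" and gf: "mat_adjoint g * f * g = f"
    and gp: "mat_adjoint g * p * mat_cnj g = (p :: complex mat)"
  shows "g * (f * p) = f * p * mat_cnj g"
proof -
  define h where "h = f * mat_adjoint g"
  note ga = mat_adjoint_carrier[OF g]
  have h: "h \<in> carrier_mat k k" unfolding h_def by (rule mult_carrier_mat[OF f ga])
  note hf = mult_carrier_mat[OF h f] and gh = mult_carrier_mat[OF g h]
  have gc: "mat_cnj g \<in> carrier_mat k k" using g by simp
  have "h * f * g = f * (mat_adjoint g * f) * g"
    unfolding h_def assoc_mult_mat[OF f ga f] ..
  also have "\<dots> = f * (mat_adjoint g * f * g)"
    by (rule assoc_mult_mat[OF f mult_carrier_mat[OF ga f] g])
  also have "\<dots> = - 1\<^sub>m k" unfolding gf ff ..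
  finally have "(- (h * f)) * g = 1\<^sub>m k"
    using hf g h f by (simp add: uminus_uminus_mat)
  \<comment> \<open>A left inverse of a square matrix is a right inverse; this turns
    \<open>g^* f g = f\<close> into \<open>g f g^* = f\<close>.\<close>
  then have "g * (- (h * f)) = 1\<^sub>m k"
    using mat_mult_left_right_inverse[OF uminus_carrier_mat[OF hf] g] by blast
  moreover have "g * (- (h * f)) = - (g * h * f)"
    unfolding assoc_mult_mat[OF g h f] using hf g by (intro uminus_mult_right_mat) auto
  ultimately have "(- (g * h * f)) * f = f"
    using f by simp
  moreover have "(- (g * h * f)) * f = - (g * h * (f * f))"
    unfolding assoc_mult_mat[OF gh f f, symmetric]
    using f mult_carrier_mat[OF gh f] by (intro uminus_mult_left_mat) auto
  moreover have "g * h * (f * f) = - (g * h * 1\<^sub>m k)"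
    unfolding ff using gh by (intro uminus_mult_right_mat) auto
  moreover have "g * h * 1\<^sub>m k = g * h"
    using gh by (rule right_mult_one_mat)
  ultimately have ghf: "g * h = f" by (simp only: uminus_uminus_mat)
  have "f * p = f * (mat_adjoint g * p * mat_cnj g)"
    unfolding gp ..
  also have "\<dots> = f * (mat_adjoint g * p) * mat_cnj g"
    by (rule assoc_mult_mat[OF f mult_carrier_mat[OF ga p] gc, symmetric])
  also have "f * (mat_adjoint g * p) = h * p"
    unfolding h_def by (rule assoc_mult_mat[OF f ga p, symmetric])
  finally have "g * (f * p) = g * (h * p * mat_cnj g)" by simp
  also have "\<dots> = g * (h * p) * mat_cnj g"
    by (rule assoc_mult_mat[OF g mult_carrier_mat[OF h p] gc, symmetric])
  also have "g * (h * p) = g * h * p"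
    by (rule assoc_mult_mat[OF g h p, symmetric])
  finally show ?thesis unfolding ghf .
qed

lemma G_inf_frak_J:
  assumes "g \<in> G_inf m r"
  shows "g * frak_J m r = frak_J m r * mat_cnj g"
proof -
  define k where "k = dim_n m r + dim_n m r"
  have k: "2 * dim_n m r = k" unfolding k_def by (rule mult_2)
  have g: "g \<in> carrier_mat k k" and gf: "mat_adjoint g * phi_inf m r * g = phi_inf m r"
    and gp: "transpose_mat g * psi_inf m r * g = psi_inf m r"
    using assms unfolding G_inf_def form_group_def k by blast+
  note f = phi_carrier[of m r, folded k_def] and p = psi_carrier[of m r, folded k_def]
  have gt: "transpose_mat g \<in> carrier_mat k k" using g by simp
  \<comment> \<open>Since \<open>psi_inf\<close> is real, conjugating the bilinear condition gives
    it the adjoint on the left and the conjugate on the right.\<close>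
  have "mat_cnj (transpose_mat g * psi_inf m r * g) = mat_adjoint g * psi_inf m r * mat_cnj g"
    unfolding mat_cnj_mult[OF mult_carrier_mat[OF gt p] g] mat_cnj_mult[OF gt p] psi_cnj mat_adjoint_eq
      map_mat_transpose ..
  then have "mat_adjoint g * psi_inf m r * mat_cnj g = psi_inf m r"
    unfolding gp psi_cnj by simp
  from intertwine_conjugate[OF g f p phi_phi[of m r, folded k_def] gf this]
  show ?thesis unfolding phi_psi .
qed

text \<open>Arbitrary frames replace \<open>U_mat\<close>, because \<open>g * U_mat m r z\<close> is
  in general only a right multiple of some \<open>U_mat m r w\<close>.\<close>

definition doubled_frame :: "nat \<Rightarrow> nat \<Rightarrow> complex mat \<Rightarrow> complex mat \<Rightarrow> complex mat" where
  "doubled_frame m r W1 W2 = minv (R_mat m r) * diag_block_mat [W1, frak_J m r * mat_cnj W2]"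

lemma AB_mat_eq: "AB_mat m r z1 z2 = doubled_frame m r (U_mat m r z1) (U_mat m r z2)"
  by (simp only: AB_mat_def doubled_frame_def)

context
  fixes m r n N :: nat
  defines "n \<equiv> dim_n m r" and "N \<equiv> dim_N m r"
begin

lemma doubling_dims [simp]:
  "phi_inf m r \<in> carrier_mat (n + n) (n + n)"
  "frak_J m r \<in> carrier_mat (n + n) (n + n)" "R_mat m r \<in> carrier_mat (N + N) (N + N)"
  "minv (R_mat m r) \<in> carrier_mat (N + N) (N + N)"
  unfolding n_def N_def
  by (rule phi_carrier frak_J_carrier R_carrier minv(1)[OF R_carrier R_det])+

lemma N_eq: "N = n + n" by (simp add: n_def N_def)

lemma diag_frame_carrier:
  assumes "W1 \<in> carrier_mat (n + n) n" "W2 \<in> carrier_mat (n + n) n"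
  shows "diag_block_mat [W1, frak_J m r * mat_cnj W2] \<in> carrier_mat (N + N) N"
  unfolding N_eq by (intro diag_block_mat_two_carrier mult_carrier_mat[of _ "n + n" "n + n"]) (use assms in auto)

lemma doubled_frame_carrier:
  assumes "W1 \<in> carrier_mat (n + n) n" "W2 \<in> carrier_mat (n + n) n"
  shows "doubled_frame m r W1 W2 \<in> carrier_mat (N + N) N"
  unfolding doubled_frame_def
  by (intro mult_carrier_mat[OF _ diag_frame_carrier[OF assms]] doubling_dims)

lemma doubled_frame_form:
  assumes W: "W1 \<in> carrier_mat (n + n) n" "W2 \<in> carrier_mat (n + n) n"
  shows "(- \<i>) \<cdot>\<^sub>m (mat_adjoint (doubled_frame m r W1 W2) * J_N m r * doubled_frame m r W1 W2)
    = diag_block_mat [(- \<i>) \<cdot>\<^sub>m (mat_adjoint W1 * phi_inf m r * W1),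
        mat_cnj ((- \<i>) \<cdot>\<^sub>m (mat_adjoint W2 * phi_inf m r * W2))]"
proof -
  let ?F = "doubled_frame m r W1 W2" and ?R = "R_mat m r" and ?f = "phi_inf m r" and ?J = "frak_J m r"
  let ?P = "diag_block_mat [?f, - ?f]" and ?V = "?J * mat_cnj W2"
  let ?D = "diag_block_mat [W1, ?V]"
  note F = doubled_frame_carrier[OF W] and D = diag_frame_carrier[OF W]
  have P: "?P \<in> carrier_mat (N + N) (N + N)"
    unfolding N_eq by (intro diag_block_mat_two_carrier) auto
  have V: "?V \<in> carrier_mat (n + n) n" and c: "mat_cnj W2 \<in> carrier_mat (n + n) n"
    using W by (auto intro: mult_carrier_mat[of _ "n + n" "n + n"])
  \<comment> \<open>Each factor \<open>R_mat\<close> supplied by \<open>R_form\<close> cancels the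
    inverse built into the doubled frame.\<close>
  have "?R * ?F = (?R * minv ?R) * ?D"
    unfolding doubled_frame_def by (rule assoc_mult_mat[OF doubling_dims(3,4) D, symmetric])
  also have "\<dots> = ?D"
    unfolding minv(2)[OF doubling_dims(3) R_det] using D by (rule left_mult_one_mat)
  finally have RF: "?R * ?F = ?D" .
  have R: "?R \<in> carrier_mat (N + N) (N + N)" by simp
  note aR = mat_adjoint_carrier[OF R] and aF = mat_adjoint_carrier[OF F]
  have PR: "?P * ?R \<in> carrier_mat (N + N) (N + N)" and PD: "?P * ?D \<in> carrier_mat (N + N) N"
    using P R D by (blast intro: mult_carrier_mat)+
  have "mat_adjoint ?F * J_N m r * ?F = mat_adjoint ?F * (J_N m r * ?F)"
    by (rule assoc_mult_mat[OF aF J_N_carrier[of m r, folded N_def] F])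
  also have "J_N m r * ?F = mat_adjoint ?R * (?P * ?R) * ?F"
    unfolding R_form[symmetric] assoc_mult_mat[OF aR P R] ..
  also have "\<dots> = mat_adjoint ?R * (?P * ?R * ?F)"
    by (rule assoc_mult_mat[OF aR PR F])
  also have "?P * ?R * ?F = ?P * ?D"
    unfolding assoc_mult_mat[OF P R F] RF ..
  also have "mat_adjoint ?F * (mat_adjoint ?R * (?P * ?D)) = mat_adjoint ?F * mat_adjoint ?R * (?P * ?D)"
    by (rule assoc_mult_mat[OF aF aR PD, symmetric])
  also have "mat_adjoint ?F * mat_adjoint ?R = mat_adjoint ?D"
    unfolding RF[symmetric] by (rule mat_adjoint_mult[OF R F, symmetric])
  also have "?P * ?D = diag_block_mat [?f * W1, - ?f * ?V]"
    by (rule diag_block_mat_two_mult[OF doubling_dims(1) uminus_carrier_mat[OF doubling_dims(1)] W(1) V])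
  also have "mat_adjoint ?D * \<dots> = diag_block_mat [mat_adjoint W1 * (?f * W1), mat_adjoint ?V * (- ?f * ?V)]"
    unfolding mat_adjoint_diag_block_mat_two
    by (rule diag_block_mat_two_mult[OF mat_adjoint_carrier[OF W(1)] mat_adjoint_carrier[OF V]
        mult_carrier_mat[OF doubling_dims(1) W(1)]
        mult_carrier_mat[OF uminus_carrier_mat[OF doubling_dims(1)] V]])
  also have "mat_adjoint W1 * (?f * W1) = mat_adjoint W1 * ?f * W1"
    by (rule assoc_mult_mat[OF mat_adjoint_carrier[OF W(1)] doubling_dims(1) W(1), symmetric])
  \<comment> \<open>\<open>frak_J\<close> preserves the hermitian form and drops out. As
    \<open>phi_inf\<close> is real, what remains is minus the conjugate of the form of
    \<open>W2\<close>.\<close>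
  also have "mat_adjoint ?V * (- ?f * ?V) = - (mat_adjoint (mat_cnj W2) * ?f * mat_cnj W2)"
  proof -
    have J: "?J \<in> carrier_mat (n + n) (n + n)" and f: "?f \<in> carrier_mat (n + n) (n + n)" by auto
    note aJ = mat_adjoint_carrier[OF J] and ac = mat_adjoint_carrier[OF c]
    have fV: "?f * ?V \<in> carrier_mat (n + n) n" using f V by (rule mult_carrier_mat)
    have "mat_adjoint ?V * (?f * ?V) = mat_adjoint (mat_cnj W2) * (mat_adjoint ?J * (?f * ?V))"
      unfolding mat_adjoint_mult[OF J c] by (rule assoc_mult_mat[OF ac aJ fV])
    also have "mat_adjoint ?J * (?f * ?V) = mat_adjoint ?J * ?f * ?V"
      by (rule assoc_mult_mat[OF aJ f V, symmetric])
    also have "\<dots> = mat_adjoint ?J * ?f * ?J * mat_cnj W2"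
      by (rule assoc_mult_mat[OF mult_carrier_mat[OF aJ f] J c, symmetric])
    also have "\<dots> = ?f * mat_cnj W2"
      unfolding frak_J_phi_frak_J ..
    also have "mat_adjoint (mat_cnj W2) * (?f * mat_cnj W2) = mat_adjoint (mat_cnj W2) * ?f * mat_cnj W2"
      by (rule assoc_mult_mat[OF ac f c, symmetric])
    finally have "mat_adjoint ?V * (?f * ?V) = mat_adjoint (mat_cnj W2) * ?f * mat_cnj W2" .
    moreover have "- ?f * ?V = - (?f * ?V)"
      by (rule uminus_mult_left_mat) (simp only: carrier_matD[OF f] carrier_matD[OF V])
    moreover have "mat_adjoint ?V * (- (?f * ?V)) = - (mat_adjoint ?V * (?f * ?V))"
      by (rule uminus_mult_right_mat) (simp only: dim_mat_adjoint carrier_matD[OF V] carrier_matD[OF fV])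
    ultimately show ?thesis by (simp only:)
  qed
  also have "mat_adjoint (mat_cnj W2) * ?f * mat_cnj W2 = mat_cnj (mat_adjoint W2 * ?f * W2)"
  proof -
    have a: "mat_adjoint W2 \<in> carrier_mat n (n + n)" and f: "?f \<in> carrier_mat (n + n) (n + n)" using W by auto
    have "mat_cnj ?f = ?f"
      unfolding phi_inf_def Let_def by (simp add: block4_cnj[where t = "2 * m" and r = r])
    then show ?thesis
      unfolding mat_cnj_mult[OF mult_carrier_mat[OF a f] W(2)] mat_cnj_mult[OF a f]
      by (simp only: mat_adjoint_eq map_mat_transpose)
  qed
  finally have eq: "mat_adjoint ?F * J_N m r * ?F =
    diag_block_mat [mat_adjoint W1 * ?f * W1, - mat_cnj (mat_adjoint W2 * ?f * W2)]" .
  show ?thesis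
    unfolding eq by (rule smult_diag_block_mat_cnj)
qed

lemma doubled_frame_lower_block:
  assumes W: "W1 \<in> carrier_mat (n + n) n" "W2 \<in> carrier_mat (n + n) n"
    and pos: "pos_def_mat ((- \<i>) \<cdot>\<^sub>m (mat_adjoint W1 * phi_inf m r * W1))"
      "pos_def_mat ((- \<i>) \<cdot>\<^sub>m (mat_adjoint W2 * phi_inf m r * W2))"
    and F: "doubled_frame m r W1 W2 = A @\<^sub>r B" "A \<in> carrier_mat N N" "B \<in> carrier_mat N N"
  shows "det B \<noteq> 0"
proof -
  have "pos_def_mat ((- \<i>) \<cdot>\<^sub>m (mat_adjoint (A @\<^sub>r B) * J_N m r * (A @\<^sub>r B)))"
    unfolding F(1)[symmetric] doubled_frame_form[OF W]
    by (rule pos_def_mat_diag_block[OF pos(1) pos_def_mat_cnj[OF pos(2)]])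
  then show ?thesis
    unfolding J_N_def Let_def N_def[symmetric]
    by (rule pos_def_off_diagonal_form_lower_block[OF F(2,3) uminus_carrier_mat[OF one_carrier_mat] one_carrier_mat])
qed

text \<open>The second frame enters conjugated, hence so does its right factor. This is the origin
  of the conjugate on the second factor of automorphy.\<close>

lemma doubled_frame_mult_right:
  assumes W: "W1 \<in> carrier_mat (n + n) n" "W2 \<in> carrier_mat (n + n) n"
    and L: "L1 \<in> carrier_mat n n" "L2 \<in> carrier_mat n n"
  shows "doubled_frame m r (W1 * L1) (W2 * L2) = doubled_frame m r W1 W2 * diag_block_mat [L1, mat_cnj L2]"
proof -
  have c: "mat_cnj W2 \<in> carrier_mat (n + n) n" "mat_cnj L2 \<in> carrier_mat n n" using W L by auto
  note V = mult_carrier_mat[OF doubling_dims(2) c(1)]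
  have L': "diag_block_mat [L1, mat_cnj L2] \<in> carrier_mat N N"
    unfolding N_eq by (rule diag_block_mat_two_carrier[OF L(1) c(2)])
  have "diag_block_mat [W1 * L1, frak_J m r * mat_cnj (W2 * L2)]
    = diag_block_mat [W1, frak_J m r * mat_cnj W2] * diag_block_mat [L1, mat_cnj L2]"
    unfolding diag_block_mat_two_mult[OF W(1) V L(1) c(2)] mat_cnj_mult[OF W(2) L(2)]
      assoc_mult_mat[OF doubling_dims(2) c] ..
  then show ?thesis
    unfolding doubled_frame_def
    using assoc_mult_mat[OF doubling_dims(4) diag_frame_carrier[OF W] L'] by (simp only:)
qed

text \<open>\<open>g2\<close> passes through \<open>frak_J\<close> and loses its conjugation, so
  \<open>diag_block_mat [g1, g2]\<close> multiplies the undoubled frames from the left. Inserting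
  \<open>R_mat\<close> times its inverse produces \<open>rho\<close>.\<close>

lemma doubled_frame_rho:
  assumes W: "W1 \<in> carrier_mat (n + n) n" "W2 \<in> carrier_mat (n + n) n"
    and g: "g1 \<in> G_inf m r" "g2 \<in> G_inf m r"
  shows "doubled_frame m r (g1 * W1) (g2 * W2) = rho m r g1 g2 * doubled_frame m r W1 W2"
proof -
  let ?R = "R_mat m r" and ?D = "diag_block_mat [W1, frak_J m r * mat_cnj W2]" and ?g = "diag_block_mat [g1, g2]"
  have g': "g1 \<in> carrier_mat (n + n) (n + n)" "g2 \<in> carrier_mat (n + n) (n + n)"
    using g unfolding G_inf_def form_group_def n_def[symmetric] mult_2[of n] by blast+
  have G: "?g \<in> carrier_mat (N + N) (N + N)"
    unfolding N_eq by (rule diag_block_mat_two_carrier[OF g'])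
  have c: "mat_cnj W2 \<in> carrier_mat (n + n) n" "mat_cnj g2 \<in> carrier_mat (n + n) (n + n)" using W g' by auto
  note V = mult_carrier_mat[OF doubling_dims(2) c(1)]
  note D = diag_frame_carrier[OF W] and R = doubling_dims(3) and iR = doubling_dims(4)
  have "frak_J m r * mat_cnj (g2 * W2) = g2 * (frak_J m r * mat_cnj W2)"
    unfolding mat_cnj_mult[OF g'(2) W(2)] assoc_mult_mat[OF doubling_dims(2) c(2,1), symmetric]
      G_inf_frak_J[OF g(2), symmetric] by (rule assoc_mult_mat[OF g'(2) doubling_dims(2) c(1)])
  then have "doubled_frame m r (g1 * W1) (g2 * W2) = minv ?R * (?g * ?D)"
    unfolding doubled_frame_def diag_block_mat_two_mult[OF g' W(1) V] by (simp only:)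
  also have "?g * ?D = ?g * (?R * minv ?R * ?D)"
    unfolding minv(2)[OF R R_det] left_mult_one_mat[OF D] ..
  also have "?R * minv ?R * ?D = ?R * (minv ?R * ?D)"
    by (rule assoc_mult_mat[OF R iR D])
  also have "minv ?R * (?g * (?R * (minv ?R * ?D))) = minv ?R * ?g * (?R * (minv ?R * ?D))"
    by (rule assoc_mult_mat[OF iR G mult_carrier_mat[OF R mult_carrier_mat[OF iR D]], symmetric])
  also have "\<dots> = minv ?R * ?g * ?R * (minv ?R * ?D)"
    by (rule assoc_mult_mat[OF mult_carrier_mat[OF iR G] R mult_carrier_mat[OF iR D], symmetric])
  finally show ?thesis unfolding rho_def doubled_frame_def .
qed

lemma G_inf_form:
  assumes W: "W \<in> carrier_mat (n + n) n" and g: "g \<in> G_inf m r"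
  shows "mat_adjoint (g * W) * phi_inf m r * (g * W) = mat_adjoint W * phi_inf m r * W"
proof -
  have g': "g \<in> carrier_mat (n + n) (n + n)" and gf: "mat_adjoint g * phi_inf m r * g = phi_inf m r"
    using g unfolding G_inf_def form_group_def n_def[symmetric] mult_2[of n] by blast+
  note f = doubling_dims(1)
  note ga = mat_adjoint_carrier[OF g'] and Wa = mat_adjoint_carrier[OF W]
  have "mat_adjoint (g * W) * phi_inf m r * (g * W) = mat_adjoint W * (mat_adjoint g * phi_inf m r) * (g * W)"
    unfolding mat_adjoint_mult[OF g' W] assoc_mult_mat[OF Wa ga f] ..
  also have "\<dots> = mat_adjoint W * (mat_adjoint g * phi_inf m r) * g * W"
    by (rule assoc_mult_mat[OF mult_carrier_mat[OF Wa mult_carrier_mat[OF ga f]] g' W, symmetric])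
  also have "mat_adjoint W * (mat_adjoint g * phi_inf m r) * g = mat_adjoint W * (mat_adjoint g * phi_inf m r * g)"
    by (rule assoc_mult_mat[OF Wa mult_carrier_mat[OF ga f] g'])
  finally show ?thesis unfolding gf .
qed

section \<open>Equivariance of the embedding and its factor of automorphy\<close>

lemma Z_inf_pos_def:
  assumes "z \<in> Z_inf m r"
  shows "z \<in> carrier_mat n n"
    "pos_def_mat ((- \<i>) \<cdot>\<^sub>m (mat_adjoint (U_mat m r z) * phi_inf m r * U_mat m r z))"
  using assms unfolding Z_inf_def form_space_def n_def[symmetric] U_mat_def by blast+

lemma act_inf_frame:
  assumes g: "g \<in> G_inf m r" and z: "z \<in> Z_inf m r"
  shows "act_inf m r g z \<in> carrier_mat n n" "autom_mat (u0 m r) g z \<in> carrier_mat n n"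
    "g * U_mat m r z = U_mat m r (act_inf m r g z) * autom_mat (u0 m r) g z"
proof -
  note zc = Z_inf_pos_def(1)[OF z]
  note u = u0_carrier[of m r, folded n_def]
  note U = U_carrier[OF zc[unfolded n_def], folded n_def]
  have g': "g \<in> carrier_mat (n + n) (n + n)"
    using g unfolding G_inf_def form_group_def n_def[symmetric] mult_2[of n] by blast
  obtain X X' Y Y' where XY: "g * U_mat m r z = X @\<^sub>r Y" "X \<in> carrier_mat n n" "Y \<in> carrier_mat n n"
    by (rule split_block_append_rows[OF mult_carrier_mat[OF g' U]])
  have p: "four_block_mat (0\<^sub>m (2 * m) r) (- 1\<^sub>m (2 * m)) (- 1\<^sub>m r) (0\<^sub>m r (2 * m)) \<in> carrier_mat n n"
    by (auto simp: n_def add.commute)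
  \<comment> \<open>The translated frame has the same positive form as the original one, so its
    lower half is invertible and the quotient defining the action makes sense.\<close>
  have "pos_def_mat ((- \<i>) \<cdot>\<^sub>m (mat_adjoint (X @\<^sub>r Y) * phi_inf m r * (X @\<^sub>r Y)))"
    unfolding XY(1)[symmetric] G_inf_form[OF U g] by (rule Z_inf_pos_def(2)[OF z])
  then have dY: "det Y \<noteq> 0"
    unfolding phi_off_diagonal n_def[symmetric]
    by (rule pos_def_off_diagonal_form_lower_block[OF XY(2,3) p u])
  note * = act_frame[OF g' zc u u0_det XY(1)[unfolded U_mat_def] XY(2,3) dY]
  show "act_inf m r g z \<in> carrier_mat n n" "autom_mat (u0 m r) g z \<in> carrier_mat n n"
    "g * U_mat m r z = U_mat m r (act_inf m r g z) * autom_mat (u0 m r) g z"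
    using * unfolding act_inf_def U_mat_def by blast+
qed

lemma AB_mat_blocks:
  assumes "z1 \<in> carrier_mat n n" "z2 \<in> carrier_mat n n"
  shows "AB_mat m r z1 z2 = A_mat m r z1 z2 @\<^sub>r B_mat m r z1 z2"
    "A_mat m r z1 z2 \<in> carrier_mat N N" "B_mat m r z1 z2 \<in> carrier_mat N N"
proof -
  note U = U_carrier[OF assms(1)[unfolded n_def], folded n_def] U_carrier[OF assms(2)[unfolded n_def], folded n_def]
  obtain X X' Y Y' where XY: "split_block (AB_mat m r z1 z2) N N = (X, X', Y, Y')"
    "AB_mat m r z1 z2 = X @\<^sub>r Y" "X \<in> carrier_mat N N" "Y \<in> carrier_mat N N"
    by (rule split_block_append_rows[OF doubled_frame_carrier[OF U, folded AB_mat_eq]])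
  have "A_mat m r z1 z2 = X" "B_mat m r z1 z2 = Y"
    unfolding A_mat_def B_mat_def N_def[symmetric] XY(1) by simp_all
  with XY show "AB_mat m r z1 z2 = A_mat m r z1 z2 @\<^sub>r B_mat m r z1 z2"
    "A_mat m r z1 z2 \<in> carrier_mat N N" "B_mat m r z1 z2 \<in> carrier_mat N N"
    by (simp_all only:)
qed

lemma iota_equivariant:
  assumes g: "g1 \<in> G_inf m r" "g2 \<in> G_inf m r" and z: "z1 \<in> Z_inf m r" "z2 \<in> Z_inf m r"
  shows "iota m r (act_inf m r g1 z1) (act_inf m r g2 z2) = act_N m r (rho m r g1 g2) (iota m r z1 z2)"
    "j_N m r (rho m r g1 g2) (iota m r z1 z2) * det (B_mat m r z1 z2)
      = j_inf m r g1 z1 * cnj (j_inf m r g2 z2) * det (B_mat m r (act_inf m r g1 z1) (act_inf m r g2 z2))"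
proof -
  let ?w1 = "act_inf m r g1 z1" and ?w2 = "act_inf m r g2 z2"
  let ?l1 = "autom_mat (u0 m r) g1 z1" and ?l2 = "autom_mat (u0 m r) g2 z2"
  let ?L = "diag_block_mat [?l1, mat_cnj ?l2]"
  let ?A = "A_mat m r z1 z2" and ?B = "B_mat m r z1 z2"
  let ?A' = "A_mat m r ?w1 ?w2" and ?B' = "B_mat m r ?w1 ?w2"
  note zc = Z_inf_pos_def(1)[OF z(1)] Z_inf_pos_def(1)[OF z(2)]
  note f1 = act_inf_frame[OF g(1) z(1)] and f2 = act_inf_frame[OF g(2) z(2)]
  note U = U_carrier[OF zc(1)[unfolded n_def], folded n_def] U_carrier[OF zc(2)[unfolded n_def], folded n_def]
  note V = U_carrier[OF f1(1)[unfolded n_def], folded n_def] U_carrier[OF f2(1)[unfolded n_def], folded n_def]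
  note AB = AB_mat_blocks[OF zc] and AB' = AB_mat_blocks[OF f1(1) f2(1)]
  have g': "g1 \<in> carrier_mat (n + n) (n + n)" "g2 \<in> carrier_mat (n + n) (n + n)"
    using g unfolding G_inf_def form_group_def n_def[symmetric] mult_2[of n] by blast+
  have c2: "mat_cnj ?l2 \<in> carrier_mat n n" using f2(2) by simp
  have L: "?L \<in> carrier_mat N N"
    unfolding N_eq by (rule diag_block_mat_two_carrier[OF f1(2) c2])
  have rho: "rho m r g1 g2 \<in> carrier_mat (N + N) (N + N)"
    unfolding rho_def
    by (rule mult_carrier_mat[OF mult_carrier_mat[OF doubling_dims(4)
      diag_block_mat_two_carrier[OF g', folded N_eq]] doubling_dims(3)])
  \<comment> \<open>The translated doubled frame is computed twice: here through the frame at the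
    image points and the right factor \<open>?L\<close>, below through left multiplication by
    \<open>rho\<close>.\<close>
  have gU: "doubled_frame m r (g1 * U_mat m r z1) (g2 * U_mat m r z2) = (?A' @\<^sub>r ?B') * ?L"
    unfolding f1(3) f2(3) doubled_frame_mult_right[OF V f1(2) f2(2)] AB'(1)[symmetric] AB_mat_eq ..
  have eq: "rho m r g1 g2 * (?A @\<^sub>r ?B) = (?A' @\<^sub>r ?B') * ?L"
    unfolding gU[symmetric] AB(1)[symmetric] AB_mat_eq by (rule doubled_frame_rho[OF U g, symmetric])
  have dB: "det ?B \<noteq> 0"
    by (rule doubled_frame_lower_block[OF U Z_inf_pos_def(2)[OF z(1)] Z_inf_pos_def(2)[OF z(2)]
      AB(1)[unfolded AB_mat_eq] AB(2,3)])
  \<comment> \<open>This is the lower half of the translated doubled frame, whose form is positive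
    by invariance. Its determinant being a product, both \<open>?B'\<close> and \<open>?L\<close>
    turn out invertible.\<close>
  have "det (?B' * ?L) \<noteq> 0"
  proof (rule doubled_frame_lower_block)
    show "g1 * U_mat m r z1 \<in> carrier_mat (n + n) n" "g2 * U_mat m r z2 \<in> carrier_mat (n + n) n"
      by (rule mult_carrier_mat[OF g'(1) U(1)] mult_carrier_mat[OF g'(2) U(2)])+
    show "pos_def_mat ((- \<i>) \<cdot>\<^sub>m (mat_adjoint (g1 * U_mat m r z1) * phi_inf m r * (g1 * U_mat m r z1)))"
      unfolding G_inf_form[OF U(1) g(1)] by (rule Z_inf_pos_def(2)[OF z(1)])
    show "pos_def_mat ((- \<i>) \<cdot>\<^sub>m (mat_adjoint (g2 * U_mat m r z2) * phi_inf m r * (g2 * U_mat m r z2)))"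
      unfolding G_inf_form[OF U(2) g(2)] by (rule Z_inf_pos_def(2)[OF z(2)])
    show "doubled_frame m r (g1 * U_mat m r z1) (g2 * U_mat m r z2) = (?A' * ?L) @\<^sub>r (?B' * ?L)"
      unfolding gU by (rule append_rows_mult[OF AB'(2,3) L])
    show "?A' * ?L \<in> carrier_mat N N" "?B' * ?L \<in> carrier_mat N N"
      by (rule mult_carrier_mat[OF AB'(2) L] mult_carrier_mat[OF AB'(3) L])+
  qed
  then have dB': "det ?B' \<noteq> 0" and dL: "det ?L \<noteq> 0"
    unfolding det_mult[OF AB'(3) L] by simp_all
  note * = act_of_frame[OF rho S_carrier[of m r, folded N_def] S_det AB(2,3) dB AB'(2,3) dB' L dL eq]
  show "iota m r ?w1 ?w2 = act_N m r (rho m r g1 g2) (iota m r z1 z2)"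
    using *(1) unfolding iota_def act_N_def by (simp only:)
  show "j_N m r (rho m r g1 g2) (iota m r z1 z2) * det ?B = j_inf m r g1 z1 * cnj (j_inf m r g2 z2) * det ?B'"
    using *(2) unfolding iota_def j_N_def j_inf_def det_diag_block_mat_two[OF f1(2) c2] det_mat_cnj
    by (simp only: autom_def)
qed

section \<open>The formula for \<open>delta\<close>, by comparing positive forms\<close>

lemma U_mat_form:
  assumes z: "z \<in> carrier_mat n n"
  shows "(- \<i>) \<cdot>\<^sub>m (mat_adjoint (U_mat m r z) * phi_inf m r * U_mat m r z) = \<i> \<cdot>\<^sub>m (mat_adjoint z - z)"
proof -
  note u = u0_carrier[of m r, folded n_def]
  define p :: "complex mat" where
    "p = four_block_mat (0\<^sub>m (2 * m) r) (- 1\<^sub>m (2 * m)) (- 1\<^sub>m r) (0\<^sub>m r (2 * m))"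
  have p: "p \<in> carrier_mat n n" by (auto simp: p_def n_def add.commute)
  \<comment> \<open>\<open>p\<close> is minus the adjoint of \<open>u0\<close>, and
    \<open>u0\<close> is a permutation matrix, so the two cross terms become minus the adjoint of
    \<open>z\<close> and \<open>z\<close> itself.\<close>
  have pu: "p * u0 m r = - 1\<^sub>m n"
  proof -
    have "p * u0 m r = four_block_mat (- 1\<^sub>m (2 * m)) (0\<^sub>m (2 * m) r) (0\<^sub>m r (2 * m)) (- 1\<^sub>m r)"
      unfolding p_def u0_def by (subst mult_four_block_mat[of _ "2 * m" r _ "2 * m" _ r _ _ "2 * m" _ r]) auto
    also have "\<dots> = - 1\<^sub>m n" by (rule eq_matI) (auto simp: n_def)
    finally show ?thesis .
  qed
  have "mat_adjoint (U_mat m r z) * phi_inf m r * U_mat m r z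
    = mat_adjoint z * (p * u0 m r) + mat_adjoint (u0 m r) * (u0 m r * z)"
    unfolding U_mat_def phi_off_diagonal n_def[symmetric] p_def[symmetric]
    by (rule off_diagonal_form[OF z u p u])
  also have "mat_adjoint (u0 m r) * (u0 m r * z) = z"
    unfolding assoc_mult_mat[OF mat_adjoint_carrier[OF u] u z, symmetric] u0_adjoint_mult n_def[symmetric]
    by (rule left_mult_one_mat[OF z])
  also have "mat_adjoint z * (p * u0 m r) = - mat_adjoint z"
  proof -
    have "mat_adjoint z * (- 1\<^sub>m n) = - (mat_adjoint z * 1\<^sub>m n)"
      by (rule uminus_mult_right_mat) (use z in simp)
    then show ?thesis
      unfolding pu right_mult_one_mat[OF mat_adjoint_carrier[OF z]] .
  qed
  finally show ?thesis
    using z by (simp only:) (rule eq_matI, auto simp: algebra_simps)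
qed

text \<open>The factor \<open>minv (S_mat m r)\<close> passes to the coordinate
  \<open>X = A * minv B\<close> with lower block \<open>1\<close>. There the form of the doubled
  frame is the form at \<open>X\<close> transformed by \<open>B\<close>, and determinants produce
  the squared modulus of \<open>det B\<close>.\<close>

lemma delta_iota:
  assumes z: "z1 \<in> Z_inf m r" "z2 \<in> Z_inf m r"
  shows "delta (iota m r z1 z2 * minv (S_mat m r))
    = of_real (cmod (det (B_mat m r z1 z2)) powi (-2)) * delta z1 * delta z2"
proof -
  let ?A = "A_mat m r z1 z2" and ?B = "B_mat m r z1 z2" and ?S = "S_mat m r"
  let ?H1 = "(- \<i>) \<cdot>\<^sub>m (mat_adjoint (U_mat m r z1) * phi_inf m r * U_mat m r z1)"
  let ?H2 = "(- \<i>) \<cdot>\<^sub>m (mat_adjoint (U_mat m r z2) * phi_inf m r * U_mat m r z2)"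
  note zc = Z_inf_pos_def(1)[OF z(1)] Z_inf_pos_def(1)[OF z(2)]
  note U = U_carrier[OF zc(1)[unfolded n_def], folded n_def] U_carrier[OF zc(2)[unfolded n_def], folded n_def]
  note AB = AB_mat_blocks[OF zc]
  note A = AB(2) and B = AB(3)
  note S = S_carrier[of m r, folded N_def]
  have dB: "det ?B \<noteq> 0"
    by (rule doubled_frame_lower_block[OF U Z_inf_pos_def(2)[OF z(1)] Z_inf_pos_def(2)[OF z(2)]
      AB(1)[unfolded AB_mat_eq] A B])
  note iB = minv[OF B dB] and iS = minv[OF S S_det]
  define X where "X = ?A * minv ?B"
  have X: "X \<in> carrier_mat N N" unfolding X_def by (rule mult_carrier_mat[OF A iB(1)])
  have "iota m r z1 z2 * minv ?S = X * (?S * minv ?S)"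
    unfolding iota_def X_def[symmetric] by (rule assoc_mult_mat[OF X S iS(1)])
  also have "\<dots> = X" unfolding iS(2) by (rule right_mult_one_mat[OF X])
  finally have iota: "iota m r z1 z2 * minv ?S = X" .
  have XB: "X * ?B = ?A"
    unfolding X_def assoc_mult_mat[OF A iB(1) B] iB(3) by (rule right_mult_one_mat[OF A])
  note Ba = mat_adjoint_carrier[OF B] and Xa = mat_adjoint_carrier[OF X]
  have H: "det ?H1 = delta z1" "det (mat_cnj ?H2) = delta z2"
  proof -
    show "det ?H1 = delta z1" unfolding U_mat_form[OF zc(1)] delta_def ..
    have H2: "?H2 \<in> carrier_mat n n" unfolding U_mat_form[OF zc(2)] using zc(2) by auto
    \<comment> \<open>The determinant of a hermitian matrix is real, so the conjugated block
      contributes \<open>delta z2\<close> itself.\<close>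
    have "mat_adjoint ?H2 = ?H2" using Z_inf_pos_def(2)[OF z(2)] by (simp only: pos_def_mat_def)
    then have "cnj (det ?H2) = det ?H2" using det_mat_adjoint[OF H2] by (simp only:)
    then show "det (mat_cnj ?H2) = delta z2"
      unfolding det_mat_cnj U_mat_form[OF zc(2)] delta_def by (simp only:)
  qed
  \<comment> \<open>With \<open>X * ?B = ?A\<close> this becomes the form of the frame. The unit
    factors on the right side match \<open>off_diagonal_form\<close> for the blocks
    \<open>-1\<close> and \<open>1\<close> of \<open>J_N\<close>.\<close>
  have "mat_adjoint ?B * (\<i> \<cdot>\<^sub>m (mat_adjoint X - X)) * ?B
    = (- \<i>) \<cdot>\<^sub>m (mat_adjoint ?A * (- 1\<^sub>m N * ?B) + mat_adjoint ?B * (1\<^sub>m N * ?A))"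
  proof -
    have "mat_adjoint ?B * (\<i> \<cdot>\<^sub>m (mat_adjoint X - X)) * ?B
      = \<i> \<cdot>\<^sub>m (mat_adjoint ?B * mat_adjoint X * ?B - mat_adjoint ?B * X * ?B)"
      by (rule mult_smult_minus_mult[OF Ba Xa X B])
    also have "mat_adjoint ?B * mat_adjoint X = mat_adjoint ?A"
      unfolding mat_adjoint_mult[OF X B, symmetric] XB ..
    also have "mat_adjoint ?B * X * ?B = mat_adjoint ?B * ?A"
      unfolding assoc_mult_mat[OF Ba X B] XB ..
    also have "\<i> \<cdot>\<^sub>m (mat_adjoint ?A * ?B - mat_adjoint ?B * ?A)
      = (- \<i>) \<cdot>\<^sub>m (- (mat_adjoint ?A * ?B) + mat_adjoint ?B * ?A)"
    proof -
      have "\<i> \<cdot>\<^sub>m (P - Q) = (- \<i>) \<cdot>\<^sub>m (- P + Q)" if "P \<in> carrier_mat N N" "Q \<in> carrier_mat N N" for P Q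
        using that by (intro eq_matI) (auto simp: algebra_simps)
      then show ?thesis
        using mult_carrier_mat[OF mat_adjoint_carrier[OF A] B] mult_carrier_mat[OF Ba A] by blast
    qed
    also have "- (mat_adjoint ?A * ?B) = mat_adjoint ?A * (- 1\<^sub>m N * ?B)"
      using A B by simp
    also have "mat_adjoint ?B * ?A = mat_adjoint ?B * (1\<^sub>m N * ?A)"
      unfolding left_mult_one_mat[OF A] ..
    finally show ?thesis .
  qed
  also have "\<dots> = (- \<i>) \<cdot>\<^sub>m (mat_adjoint (AB_mat m r z1 z2) * J_N m r * AB_mat m r z1 z2)"
    unfolding AB(1) J_N_def Let_def N_def[symmetric]
    by (subst off_diagonal_form[OF A B uminus_carrier_mat[OF one_carrier_mat] one_carrier_mat]) (rule refl)
  also have "\<dots> = diag_block_mat [?H1, mat_cnj ?H2]"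
    unfolding AB_mat_eq by (rule doubled_frame_form[OF U])
  finally have form: "mat_adjoint ?B * (\<i> \<cdot>\<^sub>m (mat_adjoint X - X)) * ?B = diag_block_mat [?H1, mat_cnj ?H2]" .
  have Y: "\<i> \<cdot>\<^sub>m (mat_adjoint X - X) \<in> carrier_mat N N" using X by auto
  have "?H1 \<in> carrier_mat n n" "mat_cnj ?H2 \<in> carrier_mat n n"
    unfolding U_mat_form[OF zc(1)] U_mat_form[OF zc(2)] using zc by auto
  then have "det (diag_block_mat [?H1, mat_cnj ?H2]) = delta z1 * delta z2"
    unfolding H[symmetric] by (rule det_diag_block_mat_two)
  then have "cnj (det ?B) * delta X * det ?B = delta z1 * delta z2"
    unfolding form[symmetric] det_mult[OF mult_carrier_mat[OF Ba Y] B] det_mult[OF Ba Y] det_mat_adjoint[OF B]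
      delta_def[of X] .
  then have "(det ?B * cnj (det ?B)) * delta X = delta z1 * delta z2"
    by (simp only: mult.commute mult.left_commute)
  then have "of_real ((cmod (det ?B))\<^sup>2) * delta X = delta z1 * delta z2"
    by (simp only: complex_norm_square)
  moreover have "of_real (cmod (det ?B) powi (-2)) * (of_real ((cmod (det ?B))\<^sup>2) :: complex) = 1"
    using dB by (simp add: power_int_minus)
  ultimately show ?thesis
    unfolding iota by (metis mult.assoc mult.left_neutral)
qed

end

text \<open>The third formula is taken at \<open>iota m r z1 z2 * minv (S_mat m r)\<close>, where
  the lower block is \<open>1\<close>; at \<open>iota m r z1 z2\<close> itself it fails for
  \<open>r > 0\<close>.\<close>

theorem proposition2p3:
  fixes m r :: nat and g1 g2 z1 z2 :: "complex mat"
  assumes "m > 1"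
    and "g1 \<in> G_inf m r" and "g2 \<in> G_inf m r"
    and "z1 \<in> Z_inf m r" and "z2 \<in> Z_inf m r"
  shows "iota m r (act_inf m r g1 z1) (act_inf m r g2 z2)
           = act_N m r (rho m r g1 g2) (iota m r z1 z2)
       \<and> j_N m r (rho m r g1 g2) (iota m r z1 z2) * det (B_mat m r z1 z2)
           = j_inf m r g1 z1 * cnj (j_inf m r g2 z2)
             * det (B_mat m r (act_inf m r g1 z1) (act_inf m r g2 z2))
       \<and> delta (iota m r z1 z2 * minv (S_mat m r))
           = of_real (cmod (det (B_mat m r z1 z2)) powi (-2)) * delta z1 * delta z2"
  using iota_equivariant[OF assms(2-5)] delta_iota[OF assms(4,5)] by blast

end
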